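(* Let $X$ be a separable Banach space (over $\mathbb{K}=\mathbb{R}$ or $\mathbb{C}$). Then the following conditions are equivalent: (a) $T(X)=2$, where $T(X)$ denotes the thickness of $X$; (b) there is a sequence $(e_n)\subset B_X$ such that for every $x\in X$ $$\lim_{n\to\infty}\|x+e_n\|=\|x\|+1;$$ (c) there is a norming subspace $Y\subset X^*$ such that the equation $$\|\mathrm{Id}+T\|=1+\|T\|$$ holds for every operator $T\colon X\to X$ of the form $T=y^*\otimes x$ with $x\in X$ and $y^*\in Y$.
   Context: $B_X$ and $S_X$ denote the closed unit ball and the unit sphere of $X$. The thickness of $X$ is $$T(X)=\inf\{\varepsilon>0:\ \text{there exists a finite } \varepsilon\text{-net for } S_X \text{ in } S_X\},$$ i.e. the infimum of those $\varepsilon>0$ such that $S_X$ can be covered by finitely many (closed) balls of radius $\varepsilon$ with centres in $S_X$. A linear subspace $Y\subset X^*$ is called norming if $\sup_{y^*\in S_Y}|y^*(x)|=\|x\|$ for every $x\in X$. For $y^*\in X^*$ and $x\in X$, $y^*\otimes x$ denotes the operator $z\mapsto y^*(z)x$ on $X$. $\mathrm{Id}$ is the identity operator on $X$. *)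

theory Defs
  imports "HOL-Analysis.Analysis"
begin

text \<open>
  The library's normed spaces are real. A normed space over a field such as the complex numbers is
  a real normed space with a compatible scalar multiplication by that field; completeness
  is then a matter of the underlying real space only. For the reals, the only such scalar
  multiplication is \<^term>\<open>scaleR\<close>.
\<close>

locale normed_space_over = vector_space scl
  for scl :: "'k::real_normed_field \<Rightarrow> 'a::real_normed_vector \<Rightarrow> 'a" +
  assumes scale_of_real: "scl (of_real r) x = r *\<^sub>R x"
    and norm_scale: "norm (scl c x) = norm c * norm x"

definition thickness :: "'a::real_normed_vector itself \<Rightarrow> real" where
  "thickness _ = Inf {\<epsilon>. 0 < \<epsilon> \<and>
     (\<exists>F. finite F \<and> F \<subseteq> sphere (0::'a) 1 \<and> sphere 0 1 \<subseteq> (\<Union>c\<in>F. cball c \<epsilon>))}"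

text \<open>
  The dual consists of the bounded real-linear maps into the scalar field that are also
  linear over that field. Its norm is the operator norm, which does not depend on whether the
  space is viewed over the reals or over the larger field.
\<close>

definition dual_space ::
  "('k::real_normed_field \<Rightarrow> 'a::real_normed_vector \<Rightarrow> 'a) \<Rightarrow> ('a \<Rightarrow>\<^sub>L 'k) set" where
  "dual_space scl = {f. \<forall>c x. blinfun_apply f (scl c x) = c * blinfun_apply f x}"

definition dual_scale ::
  "'k::real_normed_field \<Rightarrow> ('a::real_normed_vector \<Rightarrow>\<^sub>L 'k) \<Rightarrow> ('a \<Rightarrow>\<^sub>L 'k)" where
  "dual_scale c f = blinfun_mult_right c o\<^sub>L f"

lemma dual_scale_apply [simp]: "blinfun_apply (dual_scale c f) x = c * blinfun_apply f x"
  by (simp add: dual_scale_def)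

lemma vector_space_dual_scale: "vector_space dual_scale"
  by unfold_locales (auto intro!: blinfun_eqI simp: blinfun.add_left algebra_simps)

text \<open>
  If \<open>Y\<close> is the zero subspace, the supremum below ranges over the empty set and
  has an unspecified real value that is the same for every \<open>x\<close>, so such a \<open>Y\<close> is not norming unless
  the space is trivial.
\<close>

definition norming_subspace ::
  "('k::real_normed_field \<Rightarrow> 'a::real_normed_vector \<Rightarrow> 'a) \<Rightarrow> ('a \<Rightarrow>\<^sub>L 'k) set \<Rightarrow> bool" where
  "norming_subspace scl Y \<longleftrightarrow>
     Y \<subseteq> dual_space scl \<and> module.subspace dual_scale Y \<and>
     (\<forall>x. (SUP y\<in>{y \<in> Y. norm y = 1}. norm (blinfun_apply y x)) = norm x)"

definition rank_one ::
  "('k::real_normed_field \<Rightarrow> 'a::real_normed_vector \<Rightarrow> 'a) \<Rightarrow> ('a \<Rightarrow>\<^sub>L 'k) \<Rightarrow> 'a \<Rightarrow> ('a \<Rightarrow>\<^sub>L 'a)" where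
  "rank_one scl y x = Blinfun (\<lambda>z. scl (blinfun_apply y z) x)"

text \<open>\<^const>\<open>Blinfun\<close> is only meaningful on bounded linear maps, which is the case here.\<close>

lemma (in normed_space_over) rank_one_apply:
  "blinfun_apply (rank_one scl y x) z = scl (blinfun_apply y z) x"
proof -
  have "bounded_linear (\<lambda>z. scl (blinfun_apply y z) x)"
  proof (rule bounded_linear_intro[where K = "norm y * norm x"])
    fix u v r
    show "scl (y (u + v)) x = scl (y u) x + scl (y v) x"
      by (simp add: blinfun.add_right scale_left_distrib)
    have "scl (y (r *\<^sub>R u)) x = scl (of_real r * y u) x"
      by (simp add: blinfun.scaleR_right scaleR_conv_of_real)
    also have "\<dots> = scl (of_real r) (scl (y u) x)"
      by simp
    also have "\<dots> = r *\<^sub>R scl (y u) x"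
      by (rule scale_of_real)
    finally show "scl (y (r *\<^sub>R u)) x = r *\<^sub>R scl (y u) x" .
    show "norm (scl (y u) x) \<le> norm u * (norm y * norm x)"
      using mult_right_mono[OF norm_blinfun[of y u], of "norm x"]
      by (simp add: norm_scale mult_ac)
  qed
  then show ?thesis
    by (simp add: rank_one_def bounded_linear_Blinfun_apply)
qed

lemma normed_space_over_scaleR:
  "normed_space_over (scaleR :: real \<Rightarrow> 'a::real_normed_vector \<Rightarrow> 'a)"
  by unfold_locales (auto simp: algebra_simps)

end

theory Submission
  imports Defs
begin

text \<open>
  (a) and (b) are equivalent because \<open>\<parallel>x + y\<parallel>\<close> is close to \<open>\<parallel>x\<parallel> + 1\<close> for unit \<open>y\<close> as soon as
  \<open>\<parallel>x / \<parallel>x\<parallel> + y\<parallel>\<close> is close to 2, so the limit in (b) only has to be arranged along a dense sequence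
  of the sphere.

  (c) implies (a): if \<open>f \<in> Y\<close> and \<open>x\<close> have norm one, then \<open>\<parallel>Id + f \<otimes> x\<parallel> = 2\<close> together with the norming
  property gives \<open>h \<in> Y\<close> of norm one with \<open>h x\<close> nearly 1 and \<open>\<parallel>h + h x f\<parallel>\<close> nearly 2. A thin slice of the
  ball cut by this functional lies in the given slice of \<open>f\<close>, and each of its points \<open>z\<close> has \<open>\<parallel>z + x\<parallel>\<close> nearly 2.
  Iterating over finitely many \<open>x\<close> refutes finite nets of radius less than 2.

  (b) implies (c): let \<open>(d\<^sub>j)\<close> be dense in the sphere. Choose differences \<open>v\<^sub>N = e\<^sub>m - d\<^sub>j\<close> with \<open>m \<ge> N\<close>, each \<open>j\<close>
  occurring infinitely often, and let \<open>Y\<close> consist of the functionals that tend to 0 along \<open>(v\<^sub>N)\<close>. If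
  \<open>y \<in> Y\<close>, then \<open>y e\<^sub>m\<close> accumulates at every \<open>y d\<^sub>j\<close>, and testing \<open>Id + y \<otimes> x\<close> at these \<open>e\<^sub>m\<close> yields the
  Daugavet equation. For \<open>Y\<close> to be norming, the norm is relaxed step by step to seminorms that are
  small at \<open>v\<^sub>K, v\<^sub>K\<^sub>+\<^sub>1, \<dots>\<close>. The relaxed seminorms \<open>q\<close> still satisfy \<open>q (x + e\<^sub>n) \<longlonglongrightarrow> q x + 1\<close>, so for large \<open>m\<close> a
  step costs arbitrarily little at \<open>d\<^sub>0, \<dots>, d\<^sub>N\<close>, and Hahn--Banach applied to the limit seminorm
  gives elements of \<open>Y\<close> that almost attain the norm at \<open>d\<^sub>j\<close> for \<open>j \<le> K\<close>.
\<close>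

section \<open>Hahn--Banach\<close>

definition sublinear :: "('a::real_vector \<Rightarrow> real) \<Rightarrow> bool" where
  "sublinear p \<longleftrightarrow> (\<forall>x y. p (x + y) \<le> p x + p y) \<and> (\<forall>r x. 0 \<le> r \<longrightarrow> p (r *\<^sub>R x) = r * p x)"

lemma sublinearI:
  assumes "\<And>x y. p (x + y) \<le> p x + p y" and "\<And>r x. 0 < r \<Longrightarrow> p (r *\<^sub>R x) \<le> r * p x" and "p 0 = 0"
  shows "sublinear p"
proof -
  have "p (r *\<^sub>R x) = r * p x" if "0 \<le> r" for r x
  proof (cases "r = 0")
    case False
    with that have r: "0 < r" by simp
    have "p (inverse r *\<^sub>R (r *\<^sub>R x)) \<le> inverse r * p (r *\<^sub>R x)"
      using r by (intro assms(2)) simp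
    then have "r * p x \<le> p (r *\<^sub>R x)"
      using r by (simp add: field_simps)
    with assms(2)[OF r, of x] show ?thesis by simp
  qed (use assms(3) in simp)
  with assms(1) show ?thesis by (simp add: sublinear_def)
qed

lemma sublinear_add: "sublinear p \<Longrightarrow> p (x + y) \<le> p x + p y"
  and sublinear_scaleR: "sublinear p \<Longrightarrow> 0 \<le> r \<Longrightarrow> p (r *\<^sub>R x) = r * p x"
  by (auto simp: sublinear_def)

lemma sublinear_0: "sublinear p \<Longrightarrow> p 0 = 0"
  using sublinear_scaleR[of p 0 0] by simp

lemma sublinear_ge_minus: "sublinear p \<Longrightarrow> - p (- x) \<le> p x"
  using sublinear_add[of p x "- x"] sublinear_0[of p] by simp

text \<open>For sublinear \<open>p\<close> this is the largest sublinear functional below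
  \<open>p\<close> whose value at \<open>- d\<close> is at most \<open>- p d\<close>. Linear
  functionals below it therefore attain \<open>p\<close> at \<open>d\<close>.\<close>

definition sublinear_tilt :: "('a::real_vector \<Rightarrow> real) \<Rightarrow> 'a \<Rightarrow> 'a \<Rightarrow> real" where
  "sublinear_tilt p d x = (INF t\<in>{0..}. p (x + t *\<^sub>R d) - t * p d)"

lemma sublinear_tilt_lower:
  assumes "sublinear p" and "0 \<le> t"
  shows "sublinear_tilt p d x \<le> p (x + t *\<^sub>R d) - t * p d"
proof -
  have "- p (- x) \<le> p (x + t *\<^sub>R d) - t * p d" if "0 \<le> t" for t
    using sublinear_add[OF assms(1), of "- x" "x + t *\<^sub>R d"] sublinear_scaleR[OF assms(1) that, of d]
    by simp
  then have "bdd_below ((\<lambda>t. p (x + t *\<^sub>R d) - t * p d) ` {0..})"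
    by (intro bdd_belowI[of _ "- p (- x)"]) auto
  then show ?thesis
    unfolding sublinear_tilt_def using assms(2) by (intro cINF_lower) auto
qed

lemma sublinear_tilt_greatest:
  "(\<And>t. 0 \<le> t \<Longrightarrow> m \<le> p (x + t *\<^sub>R d) - t * p d) \<Longrightarrow> m \<le> sublinear_tilt p d x"
  unfolding sublinear_tilt_def by (intro cINF_greatest) auto

lemma sublinear_sublinear_tilt:
  assumes "sublinear p"
  shows "sublinear (sublinear_tilt p d)"
proof (rule sublinearI)
  fix x y
  \<comment> \<open>The parameter \<open>s\<close> for \<open>x\<close> and the parameter
    \<open>t\<close> for \<open>y\<close> combine to \<open>s + t\<close> for \<open>x + y\<close>.
    The infimum is taken over \<open>s\<close> first and then over \<open>t\<close>.\<close>
  have "sublinear_tilt p d (x + y) - (p (y + t *\<^sub>R d) - t * p d) \<le> sublinear_tilt p d x" if "0 \<le> t" for t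
  proof (rule sublinear_tilt_greatest)
    fix s :: real assume "0 \<le> s"
    with that have "sublinear_tilt p d (x + y) \<le> p ((x + y) + (s + t) *\<^sub>R d) - (s + t) * p d"
      by (intro sublinear_tilt_lower assms) simp
    also have "p ((x + y) + (s + t) *\<^sub>R d) = p ((x + s *\<^sub>R d) + (y + t *\<^sub>R d))"
      by (simp add: algebra_simps)
    also have "\<dots> \<le> p (x + s *\<^sub>R d) + p (y + t *\<^sub>R d)"
      by (rule sublinear_add[OF assms])
    finally show "sublinear_tilt p d (x + y) - (p (y + t *\<^sub>R d) - t * p d) \<le> p (x + s *\<^sub>R d) - s * p d"
      by (simp add: algebra_simps)
  qed
  then have "sublinear_tilt p d (x + y) - sublinear_tilt p d x \<le> sublinear_tilt p d y"
    by (intro sublinear_tilt_greatest) (simp add: algebra_simps)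
  then show "sublinear_tilt p d (x + y) \<le> sublinear_tilt p d x + sublinear_tilt p d y"
    by simp
next
  fix r :: real and x assume r: "0 < r"
  have "sublinear_tilt p d (r *\<^sub>R x) / r \<le> sublinear_tilt p d x"
  proof (rule sublinear_tilt_greatest)
    fix t :: real assume "0 \<le> t"
    then have "sublinear_tilt p d (r *\<^sub>R x) \<le> p (r *\<^sub>R x + (r * t) *\<^sub>R d) - (r * t) * p d"
      using r by (intro sublinear_tilt_lower assms) simp
    also have "r *\<^sub>R x + (r * t) *\<^sub>R d = r *\<^sub>R (x + t *\<^sub>R d)"
      by (simp add: algebra_simps)
    also have "p \<dots> = r * p (x + t *\<^sub>R d)"
      using r by (intro sublinear_scaleR assms) simp
    finally show "sublinear_tilt p d (r *\<^sub>R x) / r \<le> p (x + t *\<^sub>R d) - t * p d"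
      using r by (simp add: field_simps)
  qed
  then show "sublinear_tilt p d (r *\<^sub>R x) \<le> r * sublinear_tilt p d x"
    using r by (simp add: field_simps)
next
  show "sublinear_tilt p d 0 = 0"
  proof (rule antisym)
    show "sublinear_tilt p d 0 \<le> 0"
      using sublinear_tilt_lower[OF assms, of 0 d 0] sublinear_0[OF assms] by simp
    show "0 \<le> sublinear_tilt p d 0"
      by (rule sublinear_tilt_greatest) (simp add: sublinear_scaleR[OF assms])
  qed
qed

text \<open>Two members of a chain have a common lower member, namely the smaller one, so the infima
  at \<open>x\<close> and at \<open>y\<close> can be approached by the same functional. This serves
  both Zorn's lemma and the limit seminorm constructed at the end.\<close>

lemma sublinear_INF_chain:
  assumes "C \<noteq> {}" and sub: "\<And>q. q \<in> C \<Longrightarrow> sublinear q"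
    and total: "\<And>q r. q \<in> C \<Longrightarrow> r \<in> C \<Longrightarrow> q \<le> r \<or> r \<le> q"
    and bdd: "\<And>x. bdd_below ((\<lambda>q. q x) ` C)"
  shows "sublinear (\<lambda>x. INF q\<in>C. q x)"
proof (rule sublinearI)
  fix x y
  have lower: "(INF q\<in>C. q (x + y)) \<le> q x + r y" if qr: "q \<in> C" "r \<in> C" for q r
  proof -
    obtain s where s: "s \<in> C" "s \<le> q" "s \<le> r"
      using total[OF qr] qr by auto
    have "(INF q\<in>C. q (x + y)) \<le> s (x + y)"
      by (rule cINF_lower[OF bdd s(1)])
    also have "\<dots> \<le> s x + s y"
      by (rule sublinear_add[OF sub[OF s(1)]])
    also have "\<dots> \<le> q x + r y"
      using s(2,3) by (intro add_mono) (auto simp: le_fun_def)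
    finally show ?thesis .
  qed
  have "(INF q\<in>C. q (x + y)) - r y \<le> (INF q\<in>C. q x)" if "r \<in> C" for r
    using lower[OF _ that] by (intro cINF_greatest assms(1)) (simp add: algebra_simps)
  then have "(INF q\<in>C. q (x + y)) - (INF q\<in>C. q x) \<le> (INF q\<in>C. q y)"
    by (intro cINF_greatest assms(1)) (simp add: algebra_simps)
  then show "(INF q\<in>C. q (x + y)) \<le> (INF q\<in>C. q x) + (INF q\<in>C. q y)"
    by simp
next
  fix r :: real and x assume r: "0 < r"
  have "(INF q\<in>C. q (r *\<^sub>R x)) / r \<le> (INF q\<in>C. q x)"
  proof (rule cINF_greatest[OF assms(1)])
    fix q assume q: "q \<in> C"
    have "(INF q\<in>C. q (r *\<^sub>R x)) \<le> q (r *\<^sub>R x)"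
      by (rule cINF_lower[OF bdd q])
    also have "\<dots> = r * q x"
      using r by (intro sublinear_scaleR sub q) simp
    finally show "(INF q\<in>C. q (r *\<^sub>R x)) / r \<le> q x"
      using r by (simp add: field_simps)
  qed
  then show "(INF q\<in>C. q (r *\<^sub>R x)) \<le> r * (INF q\<in>C. q x)"
    using r by (simp add: field_simps)
next
  have "(INF q\<in>C. q 0) = (INF q\<in>C. 0 :: real)"
    by (intro INF_cong refl sublinear_0 sub)
  then show "(INF q\<in>C. q 0) = 0"
    using assms(1) by simp
qed

text \<open>A pointwise minimal sublinear functional cannot be lowered by tilting, so it is additive.\<close>

lemma sublinear_dominates_linear:
  assumes p: "sublinear p"
  obtains g where "linear g" and "\<And>x. g x \<le> p x"
proof -
  define A where "A = {q. sublinear q \<and> q \<le> p}"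
  have "\<exists>m\<in>A. \<forall>q\<in>A. q \<le> m \<longrightarrow> q = m"
  proof (rule predicate_Zorn)
    \<comment> \<open>The order is reversed, so that Zorn's lemma yields a minimal element and
      chains have to be bounded from below. An empty chain is bounded by \<open>p\<close>
      itself.\<close>
    show "partial_order_on A (relation_of (\<lambda>q r. r \<le> q) A)"
      by (rule partial_order_on_relation_ofI) auto
  next
    fix C assume C: "C \<in> Chains (relation_of (\<lambda>q r. r \<le> q) A)"
    then have total: "\<And>q r. q \<in> C \<Longrightarrow> r \<in> C \<Longrightarrow> q \<le> r \<or> r \<le> q"
      by (auto simp: Chains_def relation_of_def)
    have CA: "C \<subseteq> A"
      using C by (rule Chains_relation_of)
    show "\<exists>u\<in>A. \<forall>q\<in>C. u \<le> q"
    proof (cases "C = {}")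
      case True
      with p show ?thesis by (auto simp: A_def)
    next
      case False
      have bdd: "bdd_below ((\<lambda>q. q x) ` C)" for x
      proof (rule bdd_belowI2)
        fix q assume "q \<in> C"
        with CA have "sublinear q" "q (- x) \<le> p (- x)"
          by (auto simp: A_def le_fun_def)
        with sublinear_ge_minus[of q x] show "- p (- x) \<le> q x"
          by simp
      qed
      define u where "u = (\<lambda>x. INF q\<in>C. q x)"
      have lower: "u \<le> q" if "q \<in> C" for q
        unfolding u_def le_fun_def using that by (auto intro: cINF_lower bdd)
      obtain q where "q \<in> C"
        using False by blast
      with CA lower[of q] have "u \<le> p"
        by (auto simp: A_def intro: order_trans)
      moreover have "sublinear u"
        unfolding u_def using CA by (intro sublinear_INF_chain False total bdd) (auto simp: A_def)
      ultimately show ?thesis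
        using lower by (auto simp: A_def)
    qed
  qed
  then obtain m where m: "sublinear m" "m \<le> p"
    and min: "\<And>q. sublinear q \<Longrightarrow> q \<le> m \<Longrightarrow> q = m"
    by (auto simp: A_def intro: order_trans)
  have tilt: "sublinear_tilt m d = m" for d
    using sublinear_tilt_lower[OF m(1), of 0 d]
    by (intro min sublinear_sublinear_tilt m(1)) (simp add: le_fun_def)
  \<comment> \<open>The value 1 of the tilt parameter in direction \<open>y\<close> gives
    \<open>m x \<le> m (x + y) - m y\<close>, the inequality opposite to subadditivity.\<close>
  have add: "m (x + y) = m x + m y" for x y
    using sublinear_tilt_lower[OF m(1), of 1 y x] sublinear_add[OF m(1), of x y] tilt[of y] by simp
  have minus: "m (- x) = - m x" for x
    using add[of x "- x"] sublinear_0[OF m(1)] by simp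
  have "m (r *\<^sub>R x) = r * m x" for r x
    using sublinear_scaleR[OF m(1), of r x] sublinear_scaleR[OF m(1), of "- r" x] minus[of "r *\<^sub>R x"]
    by (cases "0 \<le> r") auto
  with add have "linear m"
    by (intro linearI) auto
  with m(2) show thesis
    by (intro that) (auto simp: le_fun_def)
qed

text \<open>Domination by the tilt in direction \<open>d\<close> gives
  \<open>g (- d) \<le> - p d\<close>, that is \<open>g d \<ge> p d\<close>, and the tilt lies below
  \<open>p\<close>.\<close>

lemma sublinear_attained_linear:
  assumes p: "sublinear p"
  obtains g where "linear g" and "\<And>x. g x \<le> p x" and "g d = p d"
proof -
  obtain g where g: "linear g" "\<And>x. g x \<le> sublinear_tilt p d x"
    using sublinear_dominates_linear[OF sublinear_sublinear_tilt[OF p]] by blast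
  have le: "g x \<le> p x" for x
    using g(2)[of x] sublinear_tilt_lower[OF p, of 0 d x] by simp
  have "g (- d) \<le> - p d"
    using g(2)[of "- d"] sublinear_tilt_lower[OF p, of 1 d "- d"] sublinear_0[OF p] by simp
  then have "g d = p d"
    using le[of d] linear_neg[OF g(1), of d] by simp
  with g(1) le show thesis by (intro that)
qed

section \<open>Thickness and asymptotically additive sequences\<close>

lemma thickness_eq_2_iff:
  "thickness TYPE('a::real_normed_vector) = 2 \<longleftrightarrow>
     (\<forall>F \<epsilon>. finite F \<longrightarrow> F \<subseteq> sphere (0::'a) 1 \<longrightarrow> \<epsilon> < 2 \<longrightarrow> (\<exists>z\<in>sphere 0 1. \<forall>c\<in>F. \<epsilon> < dist c z))"
    (is "_ \<longleftrightarrow> ?R")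
proof -
  define E where "E = {\<epsilon>. 0 < \<epsilon> \<and>
     (\<exists>F. finite F \<and> F \<subseteq> sphere (0::'a) 1 \<and> sphere 0 1 \<subseteq> (\<Union>c\<in>F. cball c \<epsilon>))}"
  have T: "thickness TYPE('a) = Inf E"
    by (simp add: thickness_def E_def)
  have bdd: "bdd_below E"
    by (rule bdd_belowI[of _ 0]) (auto simp: E_def)
  show ?thesis
  proof
    assume T2: "thickness TYPE('a) = 2"
    show ?R
    proof (intro allI impI)
      fix F and \<epsilon> :: real
      assume F: "finite F" "F \<subseteq> sphere (0::'a) 1" and "\<epsilon> < 2"
      \<comment> \<open>The maximum with 1 makes the radius positive, as membership in
        \<open>E\<close> requires, and keeps it below 2.\<close>
      then have "max \<epsilon> 1 < Inf E"
        using T T2 by simp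
      then have "max \<epsilon> 1 \<notin> E"
        using cInf_lower[OF _ bdd] by (meson not_less)
      with F have "\<not> sphere 0 1 \<subseteq> (\<Union>c\<in>F. cball c (max \<epsilon> 1))"
        by (auto simp: E_def)
      then obtain z where "z \<in> sphere 0 1" "\<forall>c\<in>F. \<not> dist c z \<le> max \<epsilon> 1"
        by (auto simp: subset_iff)
      then show "\<exists>z\<in>sphere 0 1. \<forall>c\<in>F. \<epsilon> < dist c z"
        by (intro bexI[of _ z]) auto
    qed
  next
    assume R: ?R
    \<comment> \<open>The empty set of centres shows that the sphere is nonempty, so the ball of
      radius 2 about one unit vector is an admissible cover.\<close>
    from R[rule_format, of "{}" 0] obtain u :: 'a where u: "norm u = 1"
      by auto
    have "dist u z \<le> 2" if "norm z = 1" for z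
      using norm_triangle_ineq4[of u z] u that by (simp add: dist_norm)
    then have "sphere 0 1 \<subseteq> cball u 2"
      by auto
    then have "2 \<in> E"
      using u by (auto simp: E_def intro!: exI[of _ "{u}"])
    moreover have "2 \<le> \<epsilon>" if "\<epsilon> \<in> E" for \<epsilon>
    proof (rule ccontr)
      assume "\<not> 2 \<le> \<epsilon>"
      moreover from that obtain F where "finite F" "F \<subseteq> sphere (0::'a) 1" "sphere 0 1 \<subseteq> (\<Union>c\<in>F. cball c \<epsilon>)"
        by (auto simp: E_def)
      moreover from calculation R obtain z where "z \<in> sphere 0 1" "\<forall>c\<in>F. \<epsilon> < dist c z"
        by (metis not_le)
      ultimately show False
        by fastforce
    qed
    ultimately show "thickness TYPE('a) = 2"
      unfolding T by (intro cInf_eq_minimum)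
  qed
qed

text \<open>If \<open>norm x \<ge> 1\<close>, then \<open>norm x *\<^sub>R (sgn x + y)\<close>
  differs from \<open>x + y\<close> by a multiple of \<open>y\<close>. Otherwise
  \<open>sgn x + y\<close> differs from \<open>x + y\<close> by a multiple of \<open>sgn x\<close>.
  The triangle inequality charges exactly the excess length.\<close>

lemma norm_add_ge_normalized:
  fixes x y :: "'a::real_normed_vector"
  assumes "norm y = 1" and "x \<noteq> 0" and "2 - \<epsilon> \<le> norm (sgn x + y)" and "0 \<le> \<epsilon>"
  shows "norm x + 1 - \<epsilon> * (norm x + 1) \<le> norm (x + y)"
proof (cases "1 \<le> norm x")
  case True
  have eq: "norm x *\<^sub>R (sgn x + y) = (x + y) + (norm x - 1) *\<^sub>R y"
    using assms(2) by (simp add: sgn_div_norm algebra_simps)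
  have "norm x * (2 - \<epsilon>) \<le> norm (norm x *\<^sub>R (sgn x + y))"
    using assms(3) by (simp add: mult_left_mono)
  also have "\<dots> \<le> norm (x + y) + (norm x - 1)"
    unfolding eq using norm_triangle_ineq[of "x + y" "(norm x - 1) *\<^sub>R y"] assms(1) True by simp
  finally show ?thesis
    using assms(4) by (simp add: algebra_simps)
next
  case False
  have eq: "sgn x + y = (x + y) + (1 - norm x) *\<^sub>R sgn x"
    using assms(2) by (simp add: sgn_div_norm algebra_simps)
  have "2 - \<epsilon> \<le> norm (x + y) + (1 - norm x)"
    using assms(3) norm_triangle_ineq[of "x + y" "(1 - norm x) *\<^sub>R sgn x"] False assms(2)
    by (subst (asm) eq) (simp add: norm_sgn)
  moreover have "0 \<le> \<epsilon> * norm x"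
    using assms(4) by simp
  ultimately show ?thesis
    by (simp add: algebra_simps)
qed

text \<open>Normalizing a countable dense set suffices: for a unit vector \<open>x\<close> the
  distance from \<open>u\<close> to \<open>sgn u\<close> is at most \<open>dist u x\<close>, so
  normalization at most doubles the distance to \<open>x\<close>.\<close>

lemma separable_sphere_dense_sequence:
  assumes "separable_space (euclidean :: 'a::real_normed_vector topology)" and "sphere (0::'a) 1 \<noteq> {}"
  obtains d :: "nat \<Rightarrow> 'a::real_normed_vector"
  where "\<And>n. norm (d n) = 1" and "\<And>x \<delta>. norm x = 1 \<Longrightarrow> 0 < \<delta> \<Longrightarrow> \<exists>n. dist (d n) x < \<delta>"
proof -
  obtain U :: "'a set" where U: "countable U" "closure U = UNIV"
    using assms(1) by (auto simp: separable_space_def)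
  have dense: "\<exists>u\<in>U - {0}. dist (sgn u) x < \<delta>" if "norm x = 1" "0 < \<delta>" for x \<delta>
  proof -
    have "x \<in> closure U" using U(2) by simp
    \<comment> \<open>A point at distance less than 1 from a unit vector is nonzero and can be
      normalized.\<close>
    moreover have "0 < min 1 (\<delta> / 2)" using that by simp
    ultimately obtain u where u: "u \<in> U" "dist u x < min 1 (\<delta> / 2)"
      unfolding closure_approachable by blast
    then have "u \<noteq> 0"
      using that by auto
    have "dist (sgn u) u = \<bar>1 - norm u\<bar>"
    proof -
      have "sgn u - u = (1 - norm u) *\<^sub>R sgn u"
        using \<open>u \<noteq> 0\<close> by (simp add: sgn_div_norm algebra_simps)
      then show ?thesis
        using \<open>u \<noteq> 0\<close> by (simp add: dist_norm norm_sgn)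
    qed
    also have "\<dots> \<le> dist u x"
      using norm_triangle_ineq3[of u x] that(1) by (simp add: dist_norm)
    finally have "dist (sgn u) x < \<delta>"
      using dist_triangle[of "sgn u" x u] u(2) by simp
    with u(1) \<open>u \<noteq> 0\<close> show ?thesis by auto
  qed
  obtain v :: 'a where "norm v = 1"
    using assms(2) by auto
  then have ne: "sgn ` (U - {0}) \<noteq> {}"
    using dense[of v 1] by auto
  define d where "d = from_nat_into (sgn ` (U - {0}))"
  have range: "range d = sgn ` (U - {0})"
    unfolding d_def by (rule range_from_nat_into[OF ne]) (use U(1) in auto)
  show thesis
  proof (rule that)
    show "norm (d n) = 1" for n
    proof -
      have "d n \<in> sgn ` (U - {0})" using range by blast
      then obtain u where "u \<noteq> 0" "d n = sgn u" by blast
      then show ?thesis by (simp add: norm_sgn)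
    qed
    show "\<exists>n. dist (d n) x < \<delta>" if x: "norm x = 1" "0 < \<delta>" for x \<delta>
    proof -
      obtain u where u: "u \<in> U - {0}" "dist (sgn u) x < \<delta>"
        using dense[OF x] by auto
      then have "sgn u \<in> range d" using range by blast
      with u(2) show ?thesis by auto
    qed
  qed
qed

lemma thickness_2_imp_asymptotically_additive:
  assumes sep: "separable_space (euclidean :: 'a::real_normed_vector topology)"
    and T: "thickness TYPE('a) = 2"
  obtains e :: "nat \<Rightarrow> 'a::real_normed_vector"
  where "range e \<subseteq> cball 0 1" and "\<And>x. (\<lambda>n. norm (x + e n)) \<longlonglongrightarrow> norm x + 1"
proof -
  note far = T[unfolded thickness_eq_2_iff, rule_format]
  have "sphere (0::'a) 1 \<noteq> {}"
    using far[of "{}" 0] by auto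
  from separable_sphere_dense_sequence[OF sep this] obtain d :: "nat \<Rightarrow> 'a"
    where d: "\<And>n. norm (d n) = 1" and dense: "\<And>x \<delta>. norm x = 1 \<Longrightarrow> 0 < \<delta> \<Longrightarrow> \<exists>n. dist (d n) x < \<delta>"
    by blast
  have "\<forall>n. \<exists>z. norm z = 1 \<and> (\<forall>k\<le>n. 2 - inverse (real (Suc n)) < norm (d k + z))"
  proof
    fix n
    \<comment> \<open>The centres are the negatives \<open>- d k\<close> because the distance from
      \<open>- d k\<close> to \<open>z\<close> is \<open>norm (d k + z)\<close>.\<close>
    have "finite ((\<lambda>k. - d k) ` {..n})" "(\<lambda>k. - d k) ` {..n} \<subseteq> sphere 0 1"
      and "2 - inverse (real (Suc n)) < 2"
      using d by auto
    from far[OF this] obtain z where "z \<in> sphere 0 1" "\<forall>k\<le>n. 2 - inverse (real (Suc n)) < dist (- d k) z"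
      by auto
    moreover have "dist (- d k) z = norm (d k + z)" for k
      by (metis dist_norm minus_add_distrib norm_minus_cancel diff_conv_add_uminus)
    ultimately show "\<exists>z. norm z = 1 \<and> (\<forall>k\<le>n. 2 - inverse (real (Suc n)) < norm (d k + z))"
      by auto
  qed
  then obtain e where e: "\<And>n. norm (e n) = 1"
    and close: "\<And>n k. k \<le> n \<Longrightarrow> 2 - inverse (real (Suc n)) < norm (d k + e n)"
    by metis
  have unit: "eventually (\<lambda>n. 2 - \<delta> \<le> norm (x + e n)) sequentially" if x: "norm x = 1" and \<delta>: "0 < \<delta>" for x \<delta>
  proof -
    obtain k where k: "dist (d k) x < \<delta> / 2"
      using dense[OF x half_gt_zero[OF \<delta>]] by blast
    have "eventually (\<lambda>n. inverse (real (Suc n)) < \<delta> / 2) sequentially"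
      using LIMSEQ_inverse_real_of_nat \<delta> by (intro order_tendstoD) auto
    then show ?thesis
      using eventually_ge_at_top[of k]
    proof eventually_elim
      case (elim n)
      have "norm (d k + e n) \<le> norm (d k - x) + norm (x + e n)"
        using norm_triangle_ineq[of "d k - x" "x + e n"] by simp
      then show ?case
        using close[OF elim(2)] elim(1) k by (simp add: dist_norm)
    qed
  qed
  have lim: "(\<lambda>n. norm (x + e n)) \<longlonglongrightarrow> norm x + 1" for x
  proof (cases "x = 0")
    case False
    show ?thesis
    proof (rule LIMSEQ_I)
      fix r :: real assume r: "0 < r"
      define \<delta> where "\<delta> = r / (2 * (norm x + 1))"
      have x1: "0 < norm x + 1"
        by (simp add: add_nonneg_pos)
      have half: "\<delta> * (norm x + 1) = r / 2"
        using x1 by (simp add: \<delta>_def field_simps)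
      have "0 < \<delta>"
        unfolding \<delta>_def using r x1 by (intro divide_pos_pos) simp_all
      then have \<delta>: "0 < \<delta>" "\<delta> * (norm x + 1) < r"
        unfolding half using r by simp_all
      obtain N where N: "\<And>n. n \<ge> N \<Longrightarrow> 2 - \<delta> \<le> norm (sgn x + e n)"
        using unit[of "sgn x" \<delta>] \<delta>(1) False by (auto simp: eventually_sequentially norm_sgn)
      have "norm (norm (x + e n) - (norm x + 1)) < r" if "n \<ge> N" for n
        using norm_add_ge_normalized[OF e False N[OF that]] norm_triangle_ineq[of x "e n"] e[of n] \<delta> by simp
      then show "\<exists>N. \<forall>n\<ge>N. norm (norm (x + e n) - (norm x + 1)) < r"
        by blast
    qed
  qed (simp add: e)
  show thesis
    using e by (intro that[of e] lim) auto
qed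

text \<open>The limit at \<open>x = 0\<close> gives
  \<open>norm (e n) \<longlonglongrightarrow> 1\<close>, so \<open>sgn (e n)\<close> is close to
  \<open>e n\<close>. For large \<open>n\<close> it is far from all of the finitely many centres
  \<open>c\<close>, by the limits at \<open>- c\<close>.\<close>

lemma asymptotically_additive_imp_thickness_2:
  fixes e :: "nat \<Rightarrow> 'a::real_normed_vector"
  assumes lim: "\<And>x. (\<lambda>n. norm (x + e n)) \<longlonglongrightarrow> norm x + 1"
  shows "thickness TYPE('a) = 2"
  unfolding thickness_eq_2_iff
proof (intro allI impI)
  fix F and \<epsilon> :: real
  assume F: "finite F" "F \<subseteq> sphere (0::'a) 1" and \<epsilon>: "\<epsilon> < 2"
  \<comment> \<open>One \<delta> is lost in the limit at \<open>- c\<close> and one in the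
    normalization. The bound \<open>1 / 2\<close> keeps \<open>e n\<close> away from 0.\<close>
  define \<delta> where "\<delta> = min (1 / 2) ((2 - \<epsilon>) / 2)"
  have \<delta>: "0 < \<delta>" "\<delta> < 1" "\<epsilon> \<le> 2 - 2 * \<delta>"
    using \<epsilon> by (auto simp: \<delta>_def min_def field_simps)
  have ne: "(\<lambda>n. norm (e n)) \<longlonglongrightarrow> 1"
    using lim[of 0] by simp
  have "eventually (\<lambda>n. \<forall>c\<in>F. 2 - \<delta> < norm (- c + e n)) sequentially"
  proof (rule eventually_ball_finite[OF F(1)], rule ballI)
    fix c assume "c \<in> F"
    with F(2) have "(\<lambda>n. norm (- c + e n)) \<longlonglongrightarrow> 2"
      using lim[of "- c"] by auto
    then show "eventually (\<lambda>n. 2 - \<delta> < norm (- c + e n)) sequentially"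
      by (rule order_tendstoD) (use \<delta> in simp)
  qed
  moreover have "eventually (\<lambda>n. 1 - \<delta> < norm (e n)) sequentially"
    by (rule order_tendstoD[OF ne]) (use \<delta> in simp)
  moreover have "eventually (\<lambda>n. norm (e n) < 1 + \<delta>) sequentially"
    by (rule order_tendstoD[OF ne]) (use \<delta> in simp)
  ultimately have "eventually (\<lambda>n. (\<forall>c\<in>F. 2 - \<delta> < norm (- c + e n)) \<and> 1 - \<delta> < norm (e n) \<and> norm (e n) < 1 + \<delta>) sequentially"
    by eventually_elim blast
  then obtain n where n: "\<forall>c\<in>F. 2 - \<delta> < norm (- c + e n)" "1 - \<delta> < norm (e n)" "norm (e n) < 1 + \<delta>"
    by (metis (no_types, lifting) eventually_happens sequentially_bot)
  then have en: "e n \<noteq> 0"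
    using \<delta> by auto
  have "e n - sgn (e n) = (norm (e n) - 1) *\<^sub>R sgn (e n)"
    using en by (simp add: sgn_div_norm algebra_simps)
  then have "norm (e n - sgn (e n)) = \<bar>norm (e n) - 1\<bar>"
    using en by (simp add: norm_sgn)
  then have diff: "norm (e n - sgn (e n)) < \<delta>"
    using n by simp
  have "\<epsilon> < dist c (sgn (e n))" if "c \<in> F" for c
  proof -
    have "norm (- c + e n) \<le> norm (sgn (e n) - c) + norm (e n - sgn (e n))"
      using norm_triangle_ineq[of "sgn (e n) - c" "e n - sgn (e n)"] by simp
    moreover have "2 - \<delta> < norm (- c + e n)"
      using n(1) that by blast
    ultimately show ?thesis
      using diff \<delta> by (simp add: dist_norm norm_minus_commute)
  qed
  then show "\<exists>z\<in>sphere 0 1. \<forall>c\<in>F. \<epsilon> < dist c z"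
    using en by (intro bexI[of _ "sgn (e n)"]) (auto simp: norm_sgn)
qed


text \<open>Pointwise asymptotic lower bounds hold at the points of a finite net, and the Lipschitz
  constant common to all \<open>n\<close> carries them to the whole compact set. Below,
  \<open>C\<close> is a closed ball of scalars.\<close>

lemma eventually_uniform_Lipschitz:
  fixes \<phi> :: "nat \<Rightarrow> 'b::metric_space \<Rightarrow> real"
  assumes C: "compact C" and L: "\<And>n a b. \<phi> n a \<le> \<phi> n b + L * dist a b"
    and ev: "\<And>a r. 0 < r \<Longrightarrow> eventually (\<lambda>n. - r \<le> \<phi> n a) sequentially" and r: "0 < r"
  shows "eventually (\<lambda>n. \<forall>a\<in>C. - r \<le> \<phi> n a) sequentially"
proof -
  \<comment> \<open>Half of \<open>r\<close> is spent at the net points and half on the Lipschitz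
    estimate. The maximum with 1 allows for \<open>L \<le> 0\<close>.\<close>
  define \<delta> where "\<delta> = r / (2 * max L 1)"
  have \<delta>: "0 < \<delta>" "max L 1 * \<delta> = r / 2"
    using r by (auto simp: \<delta>_def)
  obtain D where D: "D \<subseteq> C" "finite D" "C \<subseteq> (\<Union>b\<in>D. ball b \<delta>)"
    using compactE_image[OF C, of C "\<lambda>b. ball b \<delta>"] \<delta>(1) by force
  have "eventually (\<lambda>n. \<forall>b\<in>D. - (r / 2) \<le> \<phi> n b) sequentially"
    using r by (intro eventually_ball_finite D ballI ev) simp
  then show ?thesis
  proof eventually_elim
    case (elim n)
    show ?case
    proof
      fix a assume "a \<in> C"
      then obtain b where b: "b \<in> D" "dist b a < \<delta>"
        using D(3) by auto
      have "\<phi> n b \<le> \<phi> n a + L * dist b a"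
        by (rule L)
      also have "L * dist b a \<le> max L 1 * \<delta>"
        using b(2) by (intro mult_mono) auto
      finally show "- r \<le> \<phi> n a"
        using elim b(1) \<delta>(2) by force
    qed
  qed
qed

section \<open>Real and complex scalars together\<close>

text \<open>The properties of \<open>\<real>\<close> and \<open>\<complex>\<close> that the argument uses; \<open>lift\<close> is the passage
  from a real functional \<open>g\<close> to \<open>x \<mapsto> g x - \<i> g (\<i> x)\<close>.\<close>

locale normed_space_re = normed_space_over scl
  for scl :: "'k::{real_normed_field, heine_borel} \<Rightarrow> 'a::real_normed_vector \<Rightarrow> 'a" +
  fixes re :: "'k \<Rightarrow> real"
  assumes re_linear: "linear re"
    and re_le_norm: "re c \<le> norm c"
    and re_of_real: "re (of_real r) = r"
    and rotate: "\<exists>u. norm u = 1 \<and> u * c = of_real (norm c)"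
    and lift: "linear g \<Longrightarrow>
      \<exists>F. (\<forall>x y. F (x + y) = F x + F y) \<and> (\<forall>c x. F (scl c x) = c * F x) \<and> (\<forall>x. re (F x) = g x)"
begin

lemma re_add: "re (a + b) = re a + re b"
  and re_scaleR: "re (r *\<^sub>R a) = r * re a"
  by (simp_all add: linear_add[OF re_linear] linear_scale[OF re_linear])

lemma dual_spaceD: "f \<in> dual_space scl \<Longrightarrow> blinfun_apply f (scl c x) = c * blinfun_apply f x"
  by (simp add: dual_space_def)

lemma subspace_dual_scale_iff:
  "module.subspace dual_scale (Y :: ('a \<Rightarrow>\<^sub>L 'k) set) \<longleftrightarrow>
     0 \<in> Y \<and> (\<forall>f\<in>Y. \<forall>g\<in>Y. f + g \<in> Y) \<and> (\<forall>c. \<forall>f\<in>Y. dual_scale c f \<in> Y)"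
proof -
  have "module (dual_scale :: 'k \<Rightarrow> ('a \<Rightarrow>\<^sub>L 'k) \<Rightarrow> _)"
    by (simp add: module_iff_vector_space vector_space_dual_scale)
  then show ?thesis
    by (rule module.subspace_def)
qed

lemma norm_dual_scale: "norm (dual_scale c (f :: 'a \<Rightarrow>\<^sub>L 'k)) = norm c * norm f"
proof (rule antisym)
  have le: "norm (dual_scale c f) \<le> norm c * norm f" for c and f :: "'a \<Rightarrow>\<^sub>L 'k"
  proof (rule norm_blinfun_bound)
    show "norm (dual_scale c f x) \<le> norm c * norm f * norm x" for x
      using mult_left_mono[OF norm_blinfun[of f x], of "norm c"] by (simp add: norm_mult mult_ac)
  qed simp
  show "norm (dual_scale c f) \<le> norm c * norm f"
    by (rule le)
  show "norm c * norm f \<le> norm (dual_scale c f)"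
  proof (cases "c = 0")
    case False
    then have "f = dual_scale (inverse c) (dual_scale c f)"
      by (intro blinfun_eqI) simp
    then have "norm f \<le> norm (inverse c) * norm (dual_scale c f)"
      using le[of "inverse c" "dual_scale c f"] by simp
    with False show ?thesis
      by (simp add: norm_divide field_simps)
  qed simp
qed

lemma norm_rank_one: "norm (rank_one scl y x) = norm y * norm x"
proof (rule antisym)
  show "norm (rank_one scl y x) \<le> norm y * norm x"
  proof (rule norm_blinfun_bound)
    show "norm (rank_one scl y x z) \<le> norm y * norm x * norm z" for z
      using mult_right_mono[OF norm_blinfun[of y z], of "norm x"]
      by (simp add: rank_one_apply norm_scale mult_ac)
  qed simp
  show "norm y * norm x \<le> norm (rank_one scl y x)"
  proof (cases "x = 0")
    case False
    have "norm y \<le> norm (rank_one scl y x) / norm x"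
    proof (rule norm_blinfun_bound)
      show "norm (y z) \<le> norm (rank_one scl y x) / norm x * norm z" for z
        using norm_blinfun[of "rank_one scl y x" z] False
        by (simp add: rank_one_apply norm_scale field_simps)
    qed simp
    with False show ?thesis
      by (simp add: field_simps)
  qed simp
qed

lemma norm_id_add_rank_one_apply:
  "norm (z + scl (blinfun_apply y z) x) \<le> norm (id_blinfun + rank_one scl y x) * norm z"
  using norm_blinfun[of "id_blinfun + rank_one scl y x" z]
  by (simp add: blinfun.add_left rank_one_apply)

text \<open>Functionals in the unit ball of \<open>Y\<close> suffice in place of unit functionals,
  because normalizing \<open>f\<close> can only increase \<open>norm (f x)\<close>. Homogeneity
  extends the estimate from unit vectors to all \<open>x\<close>.\<close>

lemma norming_subspaceI:
  fixes Y :: "('a \<Rightarrow>\<^sub>L 'k) set"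
  assumes dual: "Y \<subseteq> dual_space scl" and sub: "module.subspace dual_scale Y"
    and ne: "sphere (0::'a) 1 \<noteq> {}"
    and norming: "\<And>x \<delta>. norm x = 1 \<Longrightarrow> 0 < \<delta> \<Longrightarrow> \<exists>f\<in>Y. norm f \<le> 1 \<and> 1 - \<delta> < norm (blinfun_apply f x)"
  shows "norming_subspace scl Y"
proof -
  have unit: "\<exists>f\<in>Y. norm f = 1 \<and> 1 - \<delta> < norm (blinfun_apply f x)" if x: "norm x = 1" and \<delta>: "0 < \<delta>" for x \<delta>
  proof -
    \<comment> \<open>Cutting \<delta> down to 1 makes \<open>norm (f x)\<close> positive, so that
      \<open>f\<close> can be normalized.\<close>
    obtain f where f: "f \<in> Y" "norm f \<le> 1" "1 - min \<delta> 1 < norm (f x)"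
      using norming[OF x, of "min \<delta> 1"] \<delta> by auto
    then have "f \<noteq> 0"
      by auto
    define g where "g = dual_scale (of_real (inverse (norm f))) f"
    have "norm (f x) \<le> norm (f x) / norm f"
      using f(2) \<open>f \<noteq> 0\<close> by (simp add: field_simps mult_left_le_one_le)
    then have "1 - \<delta> < norm (g x)"
      using f(3) by (simp add: g_def norm_divide norm_mult field_simps)
    moreover have "g \<in> Y"
      using sub f(1) by (simp add: g_def subspace_dual_scale_iff)
    moreover have "norm g = 1"
      using \<open>f \<noteq> 0\<close> by (simp add: g_def norm_dual_scale norm_inverse)
    ultimately show ?thesis by blast
  qed
  obtain v :: 'a where "norm v = 1"
    using ne by auto
  then have S: "{y \<in> Y. norm y = 1} \<noteq> {}"
    using unit[of v 1] by auto
  have "(SUP y\<in>{y \<in> Y. norm y = 1}. norm (blinfun_apply y x)) = norm x" for x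
  proof (rule antisym)
    have le: "norm (blinfun_apply y x) \<le> norm x" if "norm y = 1" for y :: "'a \<Rightarrow>\<^sub>L 'k"
      using norm_blinfun[of y x] that by simp
    then show "(SUP y\<in>{y \<in> Y. norm y = 1}. norm (blinfun_apply y x)) \<le> norm x"
      by (intro cSUP_least S) auto
    have bdd: "bdd_above ((\<lambda>y. norm (blinfun_apply y x)) ` {y \<in> Y. norm y = 1})"
      using le by (intro bdd_aboveI2[of _ _ "norm x"]) auto
    show "norm x \<le> (SUP y\<in>{y \<in> Y. norm y = 1}. norm (blinfun_apply y x))"
    proof (rule field_le_epsilon)
      fix r :: real assume r: "0 < r"
      have "\<exists>y\<in>Y. norm y = 1 \<and> norm x - r \<le> norm (blinfun_apply y x)"
      proof (cases "x = 0")
        case True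
        with S r show ?thesis by auto
      next
        case False
        then obtain y where y: "y \<in> Y" "norm y = 1" "1 - r / norm x < norm (blinfun_apply y (sgn x))"
          using unit[of "sgn x" "r / norm x"] r by (auto simp: norm_sgn)
        have "norm (blinfun_apply y (sgn x)) = norm (blinfun_apply y x) / norm x"
          by (simp add: sgn_div_norm blinfun.scaleR_right divide_inverse mult.commute)
        with mult_strict_left_mono[OF y(3), of "norm x"] False
        have "norm x - r < norm (blinfun_apply y x)"
          by (simp add: right_diff_distrib)
        with y(1,2) show ?thesis by (auto intro: less_imp_le)
      qed
      then obtain y where y: "y \<in> Y" "norm y = 1" "norm x - r \<le> norm (blinfun_apply y x)"
        by auto
      have "norm (blinfun_apply y x) \<le> (SUP y\<in>{y \<in> Y. norm y = 1}. norm (blinfun_apply y x))"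
        using y by (intro cSUP_upper bdd) auto
      with y(3) show "norm x \<le> (SUP y\<in>{y \<in> Y. norm y = 1}. norm (blinfun_apply y x)) + r"
        by simp
    qed
  qed
  with dual sub show ?thesis
    by (simp add: norming_subspace_def)
qed

lemma norming_subspace_approx:
  assumes "norming_subspace scl Y" and "r < norm x" and "0 \<le> r"
  obtains y where "y \<in> Y" and "norm y = 1" and "r < norm (blinfun_apply y x)"
proof -
  have eq: "(SUP y\<in>{y \<in> Y. norm y = 1}. norm (blinfun_apply y x)) = norm x" for x
    using assms(1) by (simp add: norming_subspace_def)
  have S: "{y \<in> Y. norm y = 1} \<noteq> {}"
  proof
    \<comment> \<open>The supremum over the empty set would have the same value at \<open>x\<close>
      and at 0, which forces \<open>norm x = 0\<close>.\<close>
    assume "{y \<in> Y. norm y = 1} = {}"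
    with eq[of x] eq[of 0] have "norm x = 0" by simp
    with assms show False by simp
  qed
  have bdd: "bdd_above ((\<lambda>y. norm (blinfun_apply y x)) ` {y \<in> Y. norm y = 1})"
    by (rule bdd_aboveI2[of _ _ "norm x"]) (metis (mono_tags, lifting) mem_Collect_eq mult_1 norm_blinfun)
  have "\<exists>y\<in>{y \<in> Y. norm y = 1}. r < norm (blinfun_apply y x)"
    unfolding less_cSUP_iff[OF S bdd, symmetric] eq by (rule assms(2))
  then show thesis
    using that by auto
qed

section \<open>From the Daugavet equation to thickness two\<close>

definition daugavet :: "('a \<Rightarrow>\<^sub>L 'k) set \<Rightarrow> bool" where
  "daugavet Y \<longleftrightarrow> (\<forall>x. \<forall>y\<in>Y. norm (id_blinfun + rank_one scl y x) = 1 + norm (rank_one scl y x))"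

lemma daugavet_subslice:
  assumes Y: "norming_subspace scl Y" "daugavet Y"
    and f: "f \<in> Y" "norm f = 1" and x: "norm x = 1" and \<epsilon>: "0 < \<epsilon>" "\<epsilon> \<le> 1"
  obtains g \<delta> where "g \<in> Y" and "norm g = 1" and "0 < \<delta>"
    and "\<And>z. norm z \<le> 1 \<Longrightarrow> 1 - \<delta> < re (blinfun_apply g z) \<Longrightarrow>
           1 - \<epsilon> < re (blinfun_apply f z) \<and> 2 - \<epsilon> < norm (z + x)"
proof -
  have dual: "Y \<subseteq> dual_space scl" and sub: "module.subspace dual_scale Y"
    using Y(1) by (auto simp: norming_subspace_def)
  \<comment> \<open>The final estimate loses \<open>3 * \<eta>\<close> in \<open>re (h' z)\<close>,
    because \<open>(1 - \<eta>) * (2 - \<eta>) \<ge> 2 - 3 * \<eta>\<close>, and one more \<eta> in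
    \<open>h' x = s > 1 - \<eta>\<close>.\<close>
  define \<eta> where "\<eta> = \<epsilon> / 4"
  have \<eta>: "0 < \<eta>" "4 * \<eta> = \<epsilon>"
    using \<epsilon> by (auto simp: \<eta>_def)
  let ?T = "id_blinfun + rank_one scl f x"
  have T: "norm ?T = 2"
    using Y(2) f x by (simp add: daugavet_def norm_rank_one)
  have "\<exists>z. (2 - \<eta>) * norm z < norm (?T z)"
  proof (rule ccontr)
    assume "\<not> ?thesis"
    then have "norm ?T \<le> 2 - \<eta>"
      using \<epsilon> \<eta> by (intro norm_blinfun_bound) (auto simp: not_less)
    with T \<eta> show False by simp
  qed
  then obtain z0 where z0: "(2 - \<eta>) * norm z0 < norm (z0 + scl (f z0) x)"
    by (auto simp: blinfun.add_left rank_one_apply)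
  moreover have "0 \<le> (2 - \<eta>) * norm z0"
    using \<epsilon> \<eta> by simp
  ultimately obtain h where h: "h \<in> Y" "norm h = 1" "(2 - \<eta>) * norm z0 < norm (h (z0 + scl (f z0) x))"
    using norming_subspace_approx[OF Y(1)] by blast
  obtain u where u: "norm u = 1" "u * h x = of_real (norm (h x))"
    using rotate by blast
  define s where "s = norm (h x)"
  have s: "0 \<le> s" "s \<le> 1"
    using norm_blinfun[of h x] h(2) x by (auto simp: s_def)
  define h' where "h' = dual_scale u h"
  \<comment> \<open>This is \<open>h'\<close> composed with \<open>Id + f \<otimes> x\<close>, since
    \<open>h' x = s\<close>. It nearly has norm 2, so wherever it is nearly attained on the unit
    ball both \<open>h'\<close> and \<open>f\<close> are near 1.\<close>
  define g0 where "g0 = h' + dual_scale (of_real s) f"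
  have g0: "g0 \<in> Y"
    using sub h(1) f(1) by (simp add: g0_def h'_def subspace_dual_scale_iff)
  have h': "norm h' = 1" "h' x = of_real s"
    using u h(2) by (auto simp: h'_def norm_dual_scale s_def)
  have "h \<in> dual_space scl"
    using dual h(1) by blast
  then have "u * h (z0 + scl (f z0) x) = u * h z0 + f z0 * (u * h x)"
    by (simp add: blinfun.add_right dual_spaceD algebra_simps)
  also have "\<dots> = g0 z0"
    unfolding u(2) by (simp add: g0_def h'_def blinfun.add_left s_def mult.commute)
  finally have "u * h (z0 + scl (f z0) x) = g0 z0" .
  then have "norm (h (z0 + scl (f z0) x)) = norm (g0 z0)"
    using u(1) by (metis mult_1 norm_mult)
  with h(3) norm_blinfun[of g0 z0] have "(2 - \<eta>) * norm z0 < norm g0 * norm z0"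
    by simp
  then have \<rho>: "2 - \<eta> < norm g0"
    by (rule mult_right_less_imp_less) simp
  have "norm g0 \<le> 1 + s"
    unfolding g0_def using norm_triangle_ineq[of h' "dual_scale (of_real s) f"] h'(1) f(2) s
    by (simp add: norm_dual_scale)
  with \<rho> have s1: "1 - \<eta> < s"
    by simp
  define g where "g = dual_scale (of_real (inverse (norm g0))) g0"
  have g0_pos: "0 < norm g0"
    using \<rho> \<epsilon> \<eta> by linarith
  have "g \<in> Y"
    using sub g0 by (simp add: g_def subspace_dual_scale_iff)
  moreover have "norm g = 1"
    using g0_pos by (simp add: g_def norm_dual_scale norm_inverse)
  moreover have "1 - \<epsilon> < re (f z) \<and> 2 - \<epsilon> < norm (z + x)"
    if z: "norm z \<le> 1" "1 - \<eta> < re (g z)" for z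
  proof -
    have re_le: "re (k z) \<le> 1" if "norm k = 1" for k :: "'a \<Rightarrow>\<^sub>L 'k"
      using re_le_norm[of "k z"] norm_blinfun[of k z] that z(1) by simp
    have "re (g z) = inverse (norm g0) * re (g0 z)"
      unfolding g_def dual_scale_apply scaleR_conv_of_real[symmetric] re_scaleR ..
    then have "(1 - \<eta>) * norm g0 < re (g0 z)"
      using z(2) g0_pos by (simp add: field_simps)
    moreover have "(1 - \<eta>) * (2 - \<eta>) \<le> (1 - \<eta>) * norm g0"
      using \<rho> \<epsilon> \<eta> by (intro mult_left_mono) auto
    moreover have "2 - 3 * \<eta> \<le> (1 - \<eta>) * (2 - \<eta>)"
      by (simp add: algebra_simps)
    moreover have "re (g0 z) = re (h' z) + s * re (f z)"
      by (simp add: g0_def blinfun.add_left re_add flip: scaleR_conv_of_real add: re_scaleR)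
    ultimately have sum: "2 - 3 * \<eta> < re (h' z) + s * re (f z)"
      by linarith
    \<comment> \<open>The maximum covers a negative \<open>re (f z)\<close>, for which
      multiplication by \<open>s \<le> 1\<close> goes the wrong way. Positivity of
      \<open>1 - 3 * \<eta>\<close> later rules out that the maximum is 0.\<close>
    have sf: "s * re (f z) \<le> max 0 (re (f z))"
    proof (cases "0 \<le> re (f z)")
      case True
      with s show ?thesis by (simp add: mult_left_le_one_le)
    next
      case False
      with s show ?thesis by (simp add: mult_nonneg_nonpos)
    qed
    have "1 - 3 * \<eta> < max 0 (re (f z))"
      using sum sf re_le[OF h'(1)] by linarith
    then have fz: "1 - 3 * \<eta> < re (f z)"
      using \<epsilon> \<eta> by (auto simp: max_def split: if_splits)
    have "s * re (f z) \<le> 1"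
      using sf re_le[OF f(2)] by simp
    with sum have "1 - 3 * \<eta> < re (h' z)"
      by linarith
    moreover have "re (h' (z + x)) = re (h' z) + s"
      by (simp add: blinfun.add_right h'(2) re_add re_of_real)
    moreover have "re (h' (z + x)) \<le> norm (z + x)"
      using re_le_norm[of "h' (z + x)"] norm_blinfun[of h' "z + x"] h'(1) by simp
    ultimately have "2 - 4 * \<eta> < norm (z + x)"
      using s1 by linarith
    with fz \<eta> show ?thesis by simp
  qed
  ultimately show thesis
    using \<eta>(1) by (intro that)
qed

text \<open>The induction step applies the previous lemma with parameter
  \<open>min \<delta> \<epsilon>\<close>, so the new slice lies inside the old one and the earlier
  estimates persist. Keeping \<delta> at most 1 makes this parameter admissible.\<close>

lemma daugavet_finite_subslice:
  assumes Y: "norming_subspace scl Y" "daugavet Y" and ne: "sphere (0::'a) 1 \<noteq> {}"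
    and F: "finite F" "F \<subseteq> sphere 0 1" and \<epsilon>: "0 < \<epsilon>" "\<epsilon> \<le> 1"
  shows "\<exists>g\<in>Y. \<exists>\<delta>. norm g = 1 \<and> 0 < \<delta> \<and> \<delta> \<le> 1 \<and>
    (\<forall>z. norm z \<le> 1 \<longrightarrow> 1 - \<delta> < re (blinfun_apply g z) \<longrightarrow> (\<forall>x\<in>F. 2 - \<epsilon> < norm (z + x)))"
  using F
proof (induction F rule: finite_induct)
  case empty
  obtain v :: 'a where "norm v = 1"
    using ne by auto
  then obtain g where "g \<in> Y" "norm g = 1"
    using norming_subspace_approx[OF Y(1), of 0 v] by auto
  then show ?case by (auto intro!: exI[of _ 1])
next
  case (insert x F)
  then obtain f \<delta> where f: "f \<in> Y" "norm f = 1" and \<delta>: "0 < \<delta>" "\<delta> \<le> 1"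
    and F: "\<And>z x. norm z \<le> 1 \<Longrightarrow> 1 - \<delta> < re (f z) \<Longrightarrow> x \<in> F \<Longrightarrow> 2 - \<epsilon> < norm (z + x)"
    by auto
  have x: "norm x = 1"
    using insert.prems by simp
  have m: "0 < min \<delta> \<epsilon>" "min \<delta> \<epsilon> \<le> 1"
    using \<delta> \<epsilon> by auto
  obtain g \<gamma> where g: "g \<in> Y" "norm g = 1" "0 < \<gamma>"
    and slice: "\<And>z. norm z \<le> 1 \<Longrightarrow> 1 - \<gamma> < re (g z) \<Longrightarrow>
      1 - min \<delta> \<epsilon> < re (f z) \<and> 2 - min \<delta> \<epsilon> < norm (z + x)"
    using daugavet_subslice[OF Y f x m] by blast
  have "2 - \<epsilon> < norm (z + x')"
    if z: "norm z \<le> 1" "1 - min \<gamma> 1 < re (g z)" and x': "x' \<in> insert x F" for z x'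
  proof -
    have "1 - min \<delta> \<epsilon> < re (f z)" "2 - min \<delta> \<epsilon> < norm (z + x)"
      using slice[of z] z by auto
    then show ?thesis
      using F[of z x'] x' z(1) by auto
  qed
  with g show ?case
    by (intro bexI[of _ g] exI[of _ "min \<gamma> 1"] conjI allI impI ballI) simp_all
qed

lemma daugavet_imp_thickness_2:
  assumes Y: "norming_subspace scl Y" "daugavet Y"
  shows "thickness TYPE('a) = 2"
  unfolding thickness_eq_2_iff
proof (intro allI impI)
  fix F and \<epsilon> :: real
  assume F: "finite F" "F \<subseteq> sphere (0::'a) 1" and \<epsilon>: "\<epsilon> < 2"
  \<comment> \<open>In the zero space every operator has norm 0, and the Daugavet equation for the
    zero functional would read \<open>0 = 1 + 0\<close>.\<close>
  have "\<exists>v::'a. v \<noteq> 0"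
  proof (rule ccontr)
    assume "\<not> ?thesis"
    then have zero: "v = 0" for v :: 'a by blast
    have norm_T: "norm T = 0" for T :: "'a \<Rightarrow>\<^sub>L 'a"
      by (simp, rule blinfun_eqI, rule trans[OF zero zero[symmetric]])
    have "(0 :: 'a \<Rightarrow>\<^sub>L 'k) \<in> Y"
      using Y(1) by (simp add: norming_subspace_def subspace_dual_scale_iff)
    then have "norm (id_blinfun + rank_one scl 0 0 :: 'a \<Rightarrow>\<^sub>L 'a) = 1 + norm (rank_one scl 0 0)"
      using Y(2) by (simp add: daugavet_def)
    then show False
      unfolding norm_T by simp
  qed
  then obtain v :: 'a where "v \<noteq> 0" by blast
  then have "sgn v \<in> sphere 0 1"
    by (simp add: norm_sgn)
  then have ne: "sphere (0::'a) 1 \<noteq> {}"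
    by blast
  define \<epsilon>' where "\<epsilon>' = min 1 (2 - \<epsilon>)"
  have \<epsilon>': "0 < \<epsilon>'" "\<epsilon>' \<le> 1" "\<epsilon> \<le> 2 - \<epsilon>'"
    using \<epsilon> by (auto simp: \<epsilon>'_def)
  have F': "finite (uminus ` F)" "uminus ` F \<subseteq> sphere 0 1"
    using F by auto
  obtain g \<delta> where g: "g \<in> Y" "norm g = 1" and \<delta>: "0 < \<delta>" "\<delta> \<le> 1"
    and slice: "\<And>z c. norm z \<le> 1 \<Longrightarrow> 1 - \<delta> < re (g z) \<Longrightarrow> c \<in> F \<Longrightarrow> 2 - \<epsilon>' < norm (z - c)"
    using daugavet_finite_subslice[OF Y ne F' \<epsilon>'(1,2)] by auto
  have "\<exists>z. (1 - \<delta>) * norm z < norm (g z)"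
  proof (rule ccontr)
    assume "\<not> ?thesis"
    then have "norm g \<le> 1 - \<delta>"
      using \<delta> by (intro norm_blinfun_bound) (auto simp: not_less)
    with g \<delta> show False by simp
  qed
  then obtain z where z: "(1 - \<delta>) * norm z < norm (g z)" by blast
  then have "z \<noteq> 0" by auto
  obtain u where u: "norm u = 1" "u * g (sgn z) = of_real (norm (g (sgn z)))"
    using rotate by blast
  \<comment> \<open>The rotation by \<open>u\<close> makes \<open>g w\<close> real and equal to
    \<open>norm (g (sgn z))\<close>, so \<open>w\<close> is a unit vector in the slice.\<close>
  define w where "w = scl u (sgn z)"
  have w: "norm w = 1"
    using u(1) \<open>z \<noteq> 0\<close> by (simp add: w_def norm_scale norm_sgn)
  have "g w = of_real (norm (g (sgn z)))"
    using g(1) Y(1) u(2) by (auto simp: w_def dual_spaceD norming_subspace_def)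
  then have "re (g w) = norm (g (sgn z))"
    by (simp add: re_of_real)
  also have "\<dots> = norm (g z) / norm z"
    by (simp add: sgn_div_norm blinfun.scaleR_right divide_inverse mult.commute)
  also have "\<dots> > 1 - \<delta>"
    using z \<open>z \<noteq> 0\<close> by (simp add: pos_less_divide_eq)
  finally have "1 - \<delta> < re (g w)" .
  then have "\<epsilon> < dist c w" if "c \<in> F" for c
    using slice[of w c] that w \<epsilon>'(3) by (simp add: dist_norm norm_minus_commute)
  with w show "\<exists>z\<in>sphere 0 1. \<forall>c\<in>F. \<epsilon> < dist c z"
    by (intro bexI[of _ w]) auto
qed

section \<open>From an asymptotically additive sequence to a norming subspace\<close>

definition contractive_seminorm :: "('a \<Rightarrow> real) \<Rightarrow> bool" where
  "contractive_seminorm q \<longleftrightarrow>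
     (\<forall>x y. q (x + y) \<le> q x + q y) \<and> (\<forall>c x. q (scl c x) = norm c * q x) \<and> (\<forall>x. q x \<le> norm x)"

context
  fixes q :: "'a \<Rightarrow> real"
  assumes q: "contractive_seminorm q"
begin

lemma seminorm_add: "q (x + y) \<le> q x + q y"
  and seminorm_scale: "q (scl c x) = norm c * q x"
  and seminorm_le_norm: "q x \<le> norm x"
  using q by (auto simp: contractive_seminorm_def)

lemma seminorm_minus: "q (- x) = q x"
  using seminorm_scale[of "- 1" x] by simp

lemma seminorm_0: "q 0 = 0"
  using seminorm_scale[of 0 0] by simp

lemma seminorm_nonneg: "0 \<le> q x"
  using seminorm_add[of x "- x"] by (simp add: seminorm_minus seminorm_0)

lemma seminorm_diff_le: "q x - q y \<le> norm (x - y)"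
  using seminorm_add[of "x - y" y] seminorm_le_norm[of "x - y"] by simp

lemma sublinear_seminorm: "sublinear q"
proof (rule sublinearI)
  show "q (r *\<^sub>R x) \<le> r * q x" if "0 < r" for r x
    using seminorm_scale[of "of_real r" x] that by (simp add: scale_of_real)
qed (simp_all add: seminorm_add seminorm_0)

end

lemma contractive_seminorm_norm: "contractive_seminorm norm"
  by (simp add: contractive_seminorm_def norm_scale norm_triangle_ineq)

text \<open>The largest seminorm below \<open>q\<close> whose value at \<open>v\<close> is at most \<open>\<epsilon>\<close>.\<close>

definition relax :: "('a \<Rightarrow> real) \<Rightarrow> real \<Rightarrow> 'a \<Rightarrow> 'a \<Rightarrow> real" where
  "relax q \<epsilon> v x = (INF c. q (x - scl c v) + \<epsilon> * norm c)"

lemma relax_greatest: "(\<And>c. m \<le> q (x - scl c v) + \<epsilon> * norm c) \<Longrightarrow> m \<le> relax q \<epsilon> v x"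
  unfolding relax_def by (intro cINF_greatest) auto

context
  fixes q :: "'a \<Rightarrow> real" and \<epsilon> :: real
  assumes q: "contractive_seminorm q" and \<epsilon>: "0 < \<epsilon>"
begin

lemma relax_lower: "relax q \<epsilon> v x \<le> q (x - scl c v) + \<epsilon> * norm c"
proof -
  have "bdd_below (range (\<lambda>c. q (x - scl c v) + \<epsilon> * norm c))"
    using seminorm_nonneg[OF q] \<epsilon> by (intro bdd_belowI2[of _ 0]) auto
  then show ?thesis
    unfolding relax_def by (intro cINF_lower) auto
qed

lemma relax_le: "relax q \<epsilon> v x \<le> q x"
  using relax_lower[of v x 0] by simp

lemma relax_self: "relax q \<epsilon> v v \<le> \<epsilon>"
  using relax_lower[of v v 1] by (simp add: seminorm_0[OF q])

text \<open>For subadditivity the scalars \<open>b\<close> and \<open>c\<close> chosen for the two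
  summands are added. For homogeneity the substitution of \<open>c * b\<close> for \<open>b\<close>
  gives one inequality, and its use with \<open>inverse c\<close> gives the other.\<close>

lemma contractive_seminorm_relax: "contractive_seminorm (relax q \<epsilon> v)"
proof -
  let ?r = "relax q \<epsilon> v"
  have "?r (x + y) \<le> ?r x + ?r y" for x y
  proof -
    have "?r (x + y) - (q (y - scl c v) + \<epsilon> * norm c) \<le> ?r x" for c
    proof (rule relax_greatest)
      fix b
      have "?r (x + y) \<le> q (x + y - scl (b + c) v) + \<epsilon> * norm (b + c)"
        by (rule relax_lower)
      also have "x + y - scl (b + c) v = (x - scl b v) + (y - scl c v)"
        by (simp add: scale_left_distrib)
      also have "q \<dots> \<le> q (x - scl b v) + q (y - scl c v)"
        by (rule seminorm_add[OF q])
      also have "\<epsilon> * norm (b + c) \<le> \<epsilon> * (norm b + norm c)"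
        using \<epsilon> by (simp add: norm_triangle_ineq)
      finally show "?r (x + y) - (q (y - scl c v) + \<epsilon> * norm c) \<le> q (x - scl b v) + \<epsilon> * norm b"
        by (simp add: algebra_simps)
    qed
    then have "?r (x + y) - ?r x \<le> ?r y"
      by (intro relax_greatest) (simp add: algebra_simps)
    then show ?thesis by simp
  qed
  moreover have "?r (scl c x) = norm c * ?r x" for c x
  proof -
    have le: "?r (scl c x) \<le> norm c * ?r x" if c: "c \<noteq> 0" for c x
    proof -
      have "?r (scl c x) / norm c \<le> ?r x"
      proof (rule relax_greatest)
        fix b
        have "scl c x - scl (c * b) v = scl c (x - scl b v)"
          by (simp add: scale_right_diff_distrib)
        then have "?r (scl c x) \<le> norm c * q (x - scl b v) + \<epsilon> * norm (c * b)"
          using relax_lower[of v "scl c x" "c * b"] seminorm_scale[OF q] by metis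
        then show "?r (scl c x) / norm c \<le> q (x - scl b v) + \<epsilon> * norm b"
          using c by (simp add: norm_mult field_simps)
      qed
      with c show ?thesis by (simp add: field_simps)
    qed
    show ?thesis
    proof (cases "c = 0")
      case True
      have "?r 0 = 0"
      proof (rule antisym)
        show "?r 0 \<le> 0"
          using relax_le[of v 0] by (simp add: seminorm_0[OF q])
        show "0 \<le> ?r 0"
          using seminorm_nonneg[OF q] \<epsilon> by (intro relax_greatest) simp
      qed
      with True show ?thesis by simp
    next
      case False
      then have "?r x \<le> norm (inverse c) * ?r (scl c x)"
        using le[of "inverse c" "scl c x"] by simp
      with False have "norm c * ?r x \<le> ?r (scl c x)"
        by (simp add: norm_divide field_simps)
      with le[OF False, of x] show ?thesis by simp
    qed
  qed
  moreover have "?r x \<le> norm x" for x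
    using relax_le[of v x] seminorm_le_norm[OF q, of x] by simp
  ultimately show ?thesis
    by (simp add: contractive_seminorm_def)
qed

end

text \<open>Only the lower estimate is recorded: for a contractive seminorm and
  \<open>norm (e n) \<le> 1\<close>, the bound \<open>q (x + e n) \<le> q x + 1\<close> is
  automatic.\<close>

definition asymptotically_additive :: "(nat \<Rightarrow> 'a) \<Rightarrow> ('a \<Rightarrow> real) \<Rightarrow> bool" where
  "asymptotically_additive e q \<longleftrightarrow>
     (\<forall>x r. 0 < r \<longrightarrow> eventually (\<lambda>n. q x + 1 - r \<le> q (x + e n)) sequentially)"

context
  fixes q :: "'a \<Rightarrow> real" and \<epsilon> :: real and e :: "nat \<Rightarrow> 'a"
  assumes q: "contractive_seminorm q" and \<epsilon>: "0 < \<epsilon>"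
    and e: "\<And>n. norm (e n) \<le> 1" and add: "asymptotically_additive e q"
begin

lemma asymptotically_additive_scale:
  assumes r: "0 < r"
  shows "eventually (\<lambda>n. q x + norm c - r \<le> q (x - scl c (e n))) sequentially"
proof (cases "c = 0")
  case False
  define y where "y = scl (inverse (- c)) x"
  have x: "x - scl c z = scl (- c) (y + z)" for z
    using False by (simp add: y_def scale_right_distrib scale_right_diff_distrib)
  have qx: "q x = norm c * q y"
    using x[of 0] seminorm_scale[OF q, of "- c" y] by simp
  have "eventually (\<lambda>n. q y + 1 - r / norm c \<le> q (y + e n)) sequentially"
    using add False r by (simp add: asymptotically_additive_def)
  then show ?thesis
  proof eventually_elim
    case (elim n)
    then have "norm c * (q y + 1 - r / norm c) \<le> norm c * q (y + e n)"
      by (intro mult_left_mono) auto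
    then show ?case
      unfolding x seminorm_scale[OF q] qx using False by (simp add: algebra_simps)
  qed
qed (use r in simp)

text \<open>Scalars with \<open>\<epsilon> * norm c \<ge> q x + 1\<close> satisfy the estimate
  through the penalty alone. The others form a compact ball, on which the additivity of
  \<open>q\<close> at \<open>x - scl c v\<close> is uniform.\<close>

lemma asymptotically_additive_relax: "asymptotically_additive e (relax q \<epsilon> v)"
  unfolding asymptotically_additive_def
proof (intro allI impI)
  fix x and r :: real assume r: "0 < r"
  define \<phi> where "\<phi> n c = q (x - scl c v + e n) - q (x - scl c v) - 1" for n c
  have lip: "\<phi> n a \<le> \<phi> n b + (2 * norm v) * dist a b" for n a b
  proof -
    have diff: "(x - scl a v + z) - (x - scl b v + z) = scl (b - a) v"
      "(x - scl b v) - (x - scl a v) = scl (a - b) v" for z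
      by (simp_all add: scale_left_diff_distrib)
    have "q (x - scl a v + e n) - q (x - scl b v + e n) \<le> norm (b - a) * norm v"
      using seminorm_diff_le[OF q] by (metis diff(1) norm_scale)
    moreover have "q (x - scl b v) - q (x - scl a v) \<le> norm (b - a) * norm v"
      using seminorm_diff_le[OF q] by (metis diff(2) norm_scale norm_minus_commute)
    moreover have "(2 * norm v) * dist a b = 2 * (norm (b - a) * norm v)"
      by (simp add: dist_norm norm_minus_commute)
    ultimately show ?thesis
      unfolding \<phi>_def by linarith
  qed
  have "eventually (\<lambda>n. - r \<le> \<phi> n a) sequentially" if "0 < r" for a r
    using add that unfolding asymptotically_additive_def \<phi>_def
    by (auto elim!: allE[of _ "x - scl a v"] allE[of _ r] elim: eventually_mono)
  then have "eventually (\<lambda>n. \<forall>c\<in>cball 0 ((q x + 1) / \<epsilon>). - r \<le> \<phi> n c) sequentially"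
    by (intro eventually_uniform_Lipschitz[OF _ lip] r) auto
  then show "eventually (\<lambda>n. relax q \<epsilon> v x + 1 - r \<le> relax q \<epsilon> v (x + e n)) sequentially"
  proof eventually_elim
    case (elim n)
    show ?case
    proof (rule relax_greatest)
      fix c
      show "relax q \<epsilon> v x + 1 - r \<le> q (x + e n - scl c v) + \<epsilon> * norm c"
      proof (cases "norm c \<le> (q x + 1) / \<epsilon>")
        case True
        with elim have "- r \<le> \<phi> n c"
          by (simp add: dist_norm)
        then have "q (x - scl c v) + 1 - r \<le> q (x + e n - scl c v)"
          by (simp add: \<phi>_def algebra_simps)
        with relax_lower[OF q \<epsilon>, of v x c] show ?thesis by simp
      next
        case False
        then have "q x + 1 \<le> \<epsilon> * norm c"
          using \<epsilon> by (simp add: field_simps)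
        with relax_le[OF q \<epsilon>, of v x] seminorm_nonneg[OF q, of "x + e n - scl c v"] r
        show ?thesis by simp
      qed
    qed
  qed
qed

text \<open>Asymptotically \<open>q (x - scl c (e n - y))\<close> is at least
  \<open>q (x + scl c y) + norm c\<close>, and the gain \<open>norm c\<close> outweighs the loss
  \<open>norm c * norm y\<close>. The penalty again reduces the claim to a compact ball of
  scalars.\<close>

lemma eventually_relax_ge:
  assumes y: "norm y \<le> 1" and r: "0 < r"
  shows "eventually (\<lambda>n. q x - r \<le> relax q \<epsilon> (e n - y) x) sequentially"
proof -
  define \<phi> where "\<phi> n c = q (x + scl c y - scl c (e n)) - q (x + scl c y) - norm c" for n c
  \<comment> \<open>The constant 4 is the sum of 2 from \<open>norm (y - e n)\<close>, 1 from
    \<open>norm y\<close> and 1 from the term \<open>norm c\<close>.\<close>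
  have lip: "\<phi> n a \<le> \<phi> n b + 4 * dist a b" for n a b
  proof -
    have "(x + scl a y - scl a (e n)) - (x + scl b y - scl b (e n)) = scl (a - b) (y - e n)"
      by (simp add: scale_left_diff_distrib scale_right_diff_distrib)
    then have "q (x + scl a y - scl a (e n)) - q (x + scl b y - scl b (e n)) \<le> norm (a - b) * norm (y - e n)"
      using seminorm_diff_le[OF q] by (metis norm_scale)
    also have "\<dots> \<le> norm (a - b) * 2"
      using norm_triangle_ineq4[of y "e n"] y e[of n] by (intro mult_left_mono) auto
    finally have "q (x + scl a y - scl a (e n)) - q (x + scl b y - scl b (e n)) \<le> norm (a - b) * 2" .
    moreover have "(x + scl b y) - (x + scl a y) = scl (b - a) y"
      by (simp add: scale_left_diff_distrib)
    then have "q (x + scl b y) - q (x + scl a y) \<le> norm (b - a) * norm y"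
      using seminorm_diff_le[OF q] by (metis norm_scale)
    moreover have "norm (b - a) * norm y \<le> norm (a - b)"
      using y by (simp add: norm_minus_commute mult_left_le)
    moreover have "norm b - norm a \<le> norm (a - b)"
      using norm_triangle_ineq2[of b a] by (simp add: norm_minus_commute)
    ultimately show ?thesis
      by (simp add: \<phi>_def dist_norm)
  qed
  have "eventually (\<lambda>n. - r \<le> \<phi> n c) sequentially" if "0 < r" for c r
    using asymptotically_additive_scale[OF that, of "x + scl c y" c]
    by (rule eventually_mono) (simp add: \<phi>_def)
  then have "eventually (\<lambda>n. \<forall>c\<in>cball 0 (q x / \<epsilon>). - r \<le> \<phi> n c) sequentially"
    by (intro eventually_uniform_Lipschitz[OF _ lip] r) auto
  then show ?thesis
  proof eventually_elim
    case (elim n)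
    show ?case
    proof (rule relax_greatest)
      fix c
      show "q x - r \<le> q (x - scl c (e n - y)) + \<epsilon> * norm c"
      proof (cases "norm c \<le> q x / \<epsilon>")
        case True
        with elim have "- r \<le> \<phi> n c"
          by (simp add: dist_norm)
        then have "q (x + scl c y) + norm c - r \<le> q (x + scl c y - scl c (e n))"
          by (simp add: \<phi>_def)
        also have "x + scl c y - scl c (e n) = x - scl c (e n - y)"
          by (simp add: scale_right_diff_distrib)
        finally have "q (x + scl c y) + norm c - r \<le> q (x - scl c (e n - y))" .
        moreover have "q x - q (x + scl c y) \<le> norm c * norm y"
          using seminorm_diff_le[OF q, of x "x + scl c y"] by (simp add: norm_scale)
        moreover have "norm c * norm y \<le> norm c"
          using y by (simp add: mult_left_le)
        moreover have "0 \<le> \<epsilon> * norm c"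
          using \<epsilon> by simp
        ultimately show ?thesis by linarith
      next
        case False
        then have "q x \<le> \<epsilon> * norm c"
          using \<epsilon> by (simp add: field_simps)
        with seminorm_nonneg[OF q, of "x - scl c (e n - y)"] r show ?thesis
          by simp
      qed
    qed
  qed
qed

end

text \<open>Real Hahn--Banach bounds only the real part of the lifted functional. Rotating
  \<open>x\<close> so that the value becomes real turns this into a bound on the modulus, as
  \<open>p\<close> is invariant under unit scalars.\<close>

lemma dominated_functional:
  assumes p: "sublinear p" and unit: "\<And>u x. norm u = 1 \<Longrightarrow> p (scl u x) = p x"
    and le: "\<And>x. p x \<le> norm x"
  obtains f where "f \<in> dual_space scl" and "\<And>x. norm (blinfun_apply f x) \<le> p x"
    and "p d \<le> norm (blinfun_apply f d)"
proof -
  obtain g where g: "linear g" "\<And>x. g x \<le> p x" "g d = p d"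
    using sublinear_attained_linear[OF p] by blast
  obtain F where F: "\<And>x y. F (x + y) = F x + F y" "\<And>c x. F (scl c x) = c * F x" "\<And>x. re (F x) = g x"
    using lift[OF g(1)] by blast
  have norm_F: "norm (F x) \<le> p x" for x
  proof -
    obtain u where u: "norm u = 1" "u * F x = of_real (norm (F x))"
      using rotate by blast
    have "norm (F x) = re (F (scl u x))"
      by (simp add: F(2) u(2) re_of_real)
    also have "\<dots> \<le> p (scl u x)"
      by (simp add: F(3) g(2))
    finally show ?thesis
      by (simp add: unit[OF u(1)])
  qed
  have "bounded_linear F"
  proof (rule bounded_linear_intro[where K = 1])
    show "F (r *\<^sub>R x) = r *\<^sub>R F x" for r x
      using F(2)[of "of_real r" x] by (simp add: scale_of_real scaleR_conv_of_real)
    show "norm (F x) \<le> norm x * 1" for x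
      using norm_F[of x] le[of x] by simp
  qed (rule F(1))
  then have app: "blinfun_apply (Blinfun F) = F"
    by (rule bounded_linear_Blinfun_apply)
  show thesis
  proof (rule that)
    show "Blinfun F \<in> dual_space scl"
      by (simp add: dual_space_def app F(2))
    show "norm (blinfun_apply (Blinfun F) x) \<le> p x" for x
      by (simp add: app norm_F)
    show "p d \<le> norm (blinfun_apply (Blinfun F) d)"
      using re_le_norm[of "F d"] by (simp add: app F(3) g(3))
  qed
qed

section \<open>Construction of the norming subspace\<close>

lemma asymptotically_additive_imp_norming_daugavet:
  fixes e :: "nat \<Rightarrow> 'a"
  assumes sep: "separable_space (euclidean :: 'a topology)"
    and e: "\<And>n. norm (e n) \<le> 1" and lim: "\<And>x. (\<lambda>n. norm (x + e n)) \<longlonglongrightarrow> norm x + 1"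
  shows "\<exists>Y. norming_subspace scl Y \<and> daugavet Y"
proof -
  have add_norm: "asymptotically_additive e norm"
    unfolding asymptotically_additive_def
  proof (intro allI impI)
    fix x and r :: real assume "0 < r"
    then have "eventually (\<lambda>n. norm x + 1 - r < norm (x + e n)) sequentially"
      by (intro order_tendstoD[OF lim]) simp
    then show "eventually (\<lambda>n. norm x + 1 - r \<le> norm (x + e n)) sequentially"
      by (rule eventually_mono) simp
  qed
  have ne: "sphere (0::'a) 1 \<noteq> {}"
    using asymptotically_additive_imp_thickness_2[OF lim, unfolded thickness_eq_2_iff, rule_format, of "{}" 0]
    by auto
  from separable_sphere_dense_sequence[OF sep ne] obtain d :: "nat \<Rightarrow> 'a"
    where d: "\<And>n. norm (d n) = 1" and dense: "\<And>x \<delta>. norm x = 1 \<Longrightarrow> 0 < \<delta> \<Longrightarrow> \<exists>n. dist (d n) x < \<delta>"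
    by blast
  \<comment> \<open>The first component of the pairing function takes every index \<open>j\<close>
    infinitely often.\<close>
  define w :: "nat \<Rightarrow> 'a" where "w N = d (fst (prod_decode N))" for N
  \<comment> \<open>The losses from stage \<open>K\<close> on add up to
    \<open>2 * \<epsilon> K\<close>, which tends to 0.\<close>
  define \<epsilon> :: "nat \<Rightarrow> real" where "\<epsilon> N = (1 / 2) ^ N" for N
  have \<epsilon>: "0 < \<epsilon> N" for N
    by (simp add: \<epsilon>_def)
  \<comment> \<open>Stage \<open>N\<close> keeps one seminorm for each \<open>K\<close>: the norm relaxed at the differences number \<open>K, \<dots>, N - 1\<close>.
    Starting afresh from the norm at every \<open>K\<close> makes the total loss at \<open>d j\<close>, \<open>j \<le> K\<close>, tend to 0.\<close>
  define step where "step N n P = (\<lambda>K. if K \<le> N then relax (P K) (\<epsilon> N) (e n - w N) else P K)"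
    for N n and P :: "nat \<Rightarrow> 'a \<Rightarrow> real"
  \<comment> \<open>A state consists of the current seminorms and the index last chosen. At stage
    \<open>N\<close> the seminorms numbered \<open>N\<close> and above have not been relaxed
    yet.\<close>
  define S where "S N s \<longleftrightarrow> (\<forall>K. contractive_seminorm (fst s K) \<and> asymptotically_additive e (fst s K)) \<and>
      (\<forall>K\<ge>N. fst s K = norm)" for N and s :: "(nat \<Rightarrow> 'a \<Rightarrow> real) \<times> nat"
  define R where "R N s s' \<longleftrightarrow> N \<le> snd s' \<and> fst s' = step N (snd s') (fst s) \<and>
      (\<forall>K\<le>N. \<forall>j\<le>N. fst s K (d j) - \<epsilon> N \<le> fst s' K (d j))" for N and s s' :: "(nat \<Rightarrow> 'a \<Rightarrow> real) \<times> nat"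
  have "\<exists>f. \<forall>N. S N (f N) \<and> R N (f N) (f (Suc N))"
  \<comment> \<open>How large the next index must be depends on the seminorms produced by all
    earlier choices.\<close>
  proof (rule dependent_nat_choice)
    show "\<exists>s. S 0 s"
      using contractive_seminorm_norm add_norm by (auto simp: S_def intro!: exI[of _ "\<lambda>_. norm"])
  next
    fix s N assume s: "S N s"
    then have q: "contractive_seminorm (fst s K)" "asymptotically_additive e (fst s K)" for K
      by (auto simp: S_def)
    have "eventually (\<lambda>n. \<forall>K\<in>{..N}. \<forall>j\<in>{..N}. fst s K (d j) - \<epsilon> N \<le> relax (fst s K) (\<epsilon> N) (e n - w N) (d j))
        sequentially"
      using d by (intro eventually_ball_finite ballI eventually_relax_ge q \<epsilon> e) (auto simp: w_def)
    then have "eventually (\<lambda>n. N \<le> n \<and> (\<forall>K\<in>{..N}. \<forall>j\<in>{..N}.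
        fst s K (d j) - \<epsilon> N \<le> relax (fst s K) (\<epsilon> N) (e n - w N) (d j))) sequentially"
      using eventually_ge_at_top[of N] by eventually_elim simp
    then obtain n where n: "N \<le> n" "\<And>K j. K \<le> N \<Longrightarrow> j \<le> N \<Longrightarrow>
        fst s K (d j) - \<epsilon> N \<le> relax (fst s K) (\<epsilon> N) (e n - w N) (d j)"
      by (auto dest: eventually_happens)
    have "S (Suc N) (step N n (fst s), n)"
      using s q contractive_seminorm_relax[OF q(1) \<epsilon>] asymptotically_additive_relax[OF q(1) \<epsilon> e q(2)]
      by (simp add: S_def step_def contractive_seminorm_norm add_norm)
    moreover have "R N s (step N n (fst s), n)"
      using n by (simp add: R_def step_def)
    ultimately show "\<exists>s'. S (Suc N) s' \<and> R N s s'"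
      by blast
  qed
  then obtain f where f: "\<And>N. S N (f N)" "\<And>N. R N (f N) (f (Suc N))"
    by blast
  define P where "P N = fst (f N)" for N
  define m where "m N = snd (f (Suc N))" for N
  define v where "v N = e (m N) - w N" for N
  have m: "N \<le> m N" for N
    using f(2)[of N] by (simp add: R_def m_def)
  have sn: "contractive_seminorm (P N K)" for N K
    using f(1)[of N] by (simp add: S_def P_def)
  have P_reset: "P K K = norm" for K
    using f(1)[of K] by (simp add: S_def P_def)
  have P_Suc: "P (Suc N) = step N (m N) (P N)" for N
    using f(2)[of N] by (simp add: R_def P_def m_def)
  have P_relax: "P (Suc N) K = relax (P N K) (\<epsilon> N) (v N)" if "K \<le> N" for N K
    using that by (simp add: P_Suc step_def v_def)
  have P_antimono: "P (Suc N) K x \<le> P N K x" for N K x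
    using relax_le[OF sn \<epsilon>] by (simp add: P_Suc step_def)
  have P_v: "P (Suc N) K (v N) \<le> \<epsilon> N" if "K \<le> N" for N K
    using relax_self[OF sn \<epsilon>] that by (simp add: P_relax)
  \<comment> \<open>The losses at stages \<open>K\<close> to \<open>N - 1\<close> add up to
    \<open>2 * \<epsilon> K - 2 * \<epsilon> N\<close>.\<close>
  have P_d: "1 - 2 * \<epsilon> K + 2 * \<epsilon> N \<le> P N K (d j)" if "K \<le> N" "j \<le> K" for N K j
    using that(1)
  proof (induction N rule: dec_induct)
    case base
    then show ?case by (simp add: P_reset d)
  next
    case (step N)
    then have "K \<le> N" "j \<le> N"
      using that(2) by simp_all
    then have "P N K (d j) - \<epsilon> N \<le> P (Suc N) K (d j)"
      using f(2)[of N] unfolding R_def P_def by blast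
    with step.IH show ?case
      by (simp add: \<epsilon>_def)
  qed
  have functional: "\<exists>g\<in>dual_space scl. norm g \<le> 1 \<and> (\<forall>N\<ge>K. norm (blinfun_apply g (v N)) \<le> \<epsilon> N) \<and>
      1 - 2 * \<epsilon> K \<le> norm (blinfun_apply g (d j))" if j: "j \<le> K" for K j
  proof -
    \<comment> \<open>The seminorms decrease with \<open>N\<close>, so their infimum is again
      sublinear. It is at most \<open>\<epsilon> N\<close> at \<open>v N\<close> for
      \<open>N \<ge> K\<close> and still nearly 1 at \<open>d j\<close>.\<close>
    define p where "p x = (INF q\<in>range (\<lambda>N. P N K). q x)" for x
    have bdd: "bdd_below ((\<lambda>q. q x) ` range (\<lambda>N. P N K))" for x
      using seminorm_nonneg[OF sn] by (intro bdd_belowI[of _ 0]) auto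
    have p_le: "p x \<le> P N K x" for N x
      unfolding p_def by (intro cINF_lower bdd) auto
    have total: "q \<le> r \<or> r \<le> q" if "q \<in> range (\<lambda>N. P N K)" "r \<in> range (\<lambda>N. P N K)" for q r
    proof -
      have "P N K \<le> P M K" if "M \<le> N" for M N
        using that by (rule lift_Suc_antimono_le[rotated]) (simp add: le_fun_def P_antimono)
      then show ?thesis
        using that by (metis nat_le_linear rangeE)
    qed
    have "sublinear p"
      unfolding p_def using sublinear_seminorm[OF sn] by (intro sublinear_INF_chain total bdd) auto
    moreover have "p (scl u x) = p x" if "norm u = 1" for u x
      using that by (simp add: p_def image_image seminorm_scale[OF sn])
    moreover have "p x \<le> norm x" for x
      using p_le[of x 0] seminorm_le_norm[OF sn, of 0 K x] by simp
    ultimately obtain g where g: "g \<in> dual_space scl" "\<And>x. norm (blinfun_apply g x) \<le> p x"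
        "p (d j) \<le> norm (blinfun_apply g (d j))"
      using dominated_functional[of p "d j"] by blast
    have "norm g \<le> 1"
      using g(2) \<open>\<And>x. p x \<le> norm x\<close> by (intro norm_blinfun_bound) (auto intro: order_trans)
    moreover have "norm (g (v N)) \<le> \<epsilon> N" if "K \<le> N" for N
      using g(2)[of "v N"] p_le[of "v N" "Suc N"] P_v[OF that] by simp
    moreover have "1 - 2 * \<epsilon> K \<le> p (d j)"
      unfolding p_def
    proof (rule cINF_greatest)
      fix q assume "q \<in> range (\<lambda>N. P N K)"
      then obtain N where q: "q = P N K" by blast
      show "1 - 2 * \<epsilon> K \<le> q (d j)"
      proof (cases "K \<le> N")
        case True
        with P_d[OF True j] \<epsilon>[of N] q show ?thesis by simp
      next
        case False
        with f(1)[of N] have "q = norm"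
          using q by (simp add: S_def P_def)
        with \<epsilon>[of K] show ?thesis by (simp add: d)
      qed
    qed simp
    ultimately show ?thesis
      using g(1,3) by (intro bexI[of _ g]) auto
  qed
  define Y where "Y = {g \<in> dual_space scl. (\<lambda>N. blinfun_apply g (v N)) \<longlonglongrightarrow> 0}"
  have \<epsilon>_lim: "\<epsilon> \<longlonglongrightarrow> 0"
    unfolding \<epsilon>_def by (rule LIMSEQ_power_zero) simp
  have "norming_subspace scl Y"
  proof (rule norming_subspaceI[OF _ _ ne])
    show "Y \<subseteq> dual_space scl"
      by (auto simp: Y_def)
    show "module.subspace dual_scale Y"
      unfolding subspace_dual_scale_iff
      by (auto simp: Y_def dual_space_def blinfun.add_left algebra_simps
          intro: tendsto_add_zero tendsto_mult_right_zero)
    fix x :: 'a and \<delta> :: real assume x: "norm x = 1" and \<delta>: "0 < \<delta>"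
    obtain j where j: "dist (d j) x < \<delta> / 2"
      using dense[OF x half_gt_zero[OF \<delta>]] by blast
    \<comment> \<open>Half of \<delta> pays for \<open>2 * \<epsilon> K\<close>, the other half for
      replacing \<open>x\<close> by \<open>d j\<close>.\<close>
    have "eventually (\<lambda>K. \<epsilon> K < \<delta> / 4 \<and> j \<le> K) sequentially"
      using \<delta> by (intro eventually_conj eventually_ge_at_top order_tendstoD[OF \<epsilon>_lim]) simp
    then obtain K where K: "\<epsilon> K < \<delta> / 4" "j \<le> K"
      by (auto dest: eventually_happens)
    obtain g where g: "g \<in> dual_space scl" "norm g \<le> 1" "\<And>N. K \<le> N \<Longrightarrow> norm (blinfun_apply g (v N)) \<le> \<epsilon> N"
        "1 - 2 * \<epsilon> K \<le> norm (blinfun_apply g (d j))"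
      using functional[OF K(2)] by blast
    have "(\<lambda>N. g (v N)) \<longlonglongrightarrow> 0"
      using g(3) by (intro Lim_null_comparison[OF _ \<epsilon>_lim] eventually_sequentiallyI)
    with g(1) have "g \<in> Y"
      by (simp add: Y_def)
    moreover have "1 - \<delta> < norm (g x)"
    proof -
      have "norm (g (d j - x)) \<le> norm (d j - x)"
        using norm_blinfun[of g "d j - x"] mult_right_mono[OF g(2), of "norm (d j - x)"] by simp
      moreover have "norm (g (d j)) \<le> norm (g (d j - x)) + norm (g x)"
        using norm_triangle_ineq[of "g (d j - x)" "g x"] by (simp add: blinfun.diff_right)
      ultimately show ?thesis
        using j K(1) g(4) by (simp add: dist_norm)
    qed
    ultimately show "\<exists>f\<in>Y. norm f \<le> 1 \<and> 1 - \<delta> < norm (blinfun_apply f x)"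
      using g(2) by blast
  qed
  moreover have "daugavet Y"
    unfolding daugavet_def
  proof (intro allI ballI antisym)
    fix x y assume y: "y \<in> Y"
    let ?T = "id_blinfun + rank_one scl y x"
    show "norm ?T \<le> 1 + norm (rank_one scl y x)"
      using norm_triangle_ineq[of id_blinfun "rank_one scl y x"] norm_blinfun_id_le[where 'a = 'a] by linarith
    have bound: "1 + norm (y (d n)) * norm x \<le> norm ?T" for n
    proof -
      \<comment> \<open>These are stages at which \<open>w\<close> equals \<open>d n\<close>. Along
        them \<open>y\<close> tends to 0 on the differences, so \<open>y (c i)\<close> tends to
        \<open>y (d n)\<close>.\<close>
      define N where "N i = prod_encode (n, i)" for i
      define c where "c i = e (m (N i))" for i
      have N: "i \<le> N i" for i
        by (simp add: N_def le_prod_encode_2)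
      then have N_lim: "filterlim N at_top sequentially"
        by (intro filterlim_at_top_mono[OF filterlim_ident] always_eventually allI)
      have mN_lim: "filterlim (\<lambda>i. m (N i)) at_top sequentially"
        using N m order_trans by (intro filterlim_at_top_mono[OF filterlim_ident] always_eventually allI) blast
      have "c i = v (N i) + d n" for i
        by (simp add: c_def v_def w_def N_def)
      then have "(\<lambda>i. y (v (N i)) + y (d n)) = (\<lambda>i. y (c i))"
        by (simp add: blinfun.add_right)
      moreover have "(\<lambda>i. y (v (N i))) \<longlonglongrightarrow> 0"
        using y by (intro filterlim_compose[OF _ N_lim]) (simp add: Y_def)
      ultimately have yc: "(\<lambda>i. y (c i)) \<longlonglongrightarrow> y (d n)"
        using tendsto_add[of _ 0 sequentially "\<lambda>_. y (d n)" "y (d n)"] by fastforce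
      have "(\<lambda>i. norm (scl (y (d n)) x + c i)) \<longlonglongrightarrow> norm (scl (y (d n)) x) + 1"
        unfolding c_def by (rule filterlim_compose[OF lim mN_lim])
      moreover have "(\<lambda>i. norm (y (c i) - y (d n)) * norm x) \<longlonglongrightarrow> 0"
        by (intro tendsto_mult_left_zero tendsto_norm_zero) (use yc in \<open>simp add: LIM_zero\<close>)
      ultimately have "(\<lambda>i. norm (scl (y (d n)) x + c i) - norm (y (c i) - y (d n)) * norm x) \<longlonglongrightarrow>
          norm (scl (y (d n)) x) + 1 - 0"
        by (rule tendsto_diff)
      moreover have "norm (scl (y (d n)) x + c i) - norm (y (c i) - y (d n)) * norm x \<le> norm ?T" for i
      proof -
        \<comment> \<open>The term \<open>c i + scl (y (c i)) x\<close> is the value of the operator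
          at \<open>c i\<close>, a point of the unit ball.\<close>
        have "scl (y (d n)) x + c i = (c i + scl (y (c i)) x) - scl (y (c i) - y (d n)) x"
          by (simp add: scale_left_diff_distrib)
        then have "norm (scl (y (d n)) x + c i) \<le> norm (c i + scl (y (c i)) x) + norm (y (c i) - y (d n)) * norm x"
          by (metis norm_triangle_ineq4 norm_scale)
        moreover have "norm (c i + scl (y (c i)) x) \<le> norm ?T"
          using norm_id_add_rank_one_apply[of "c i" y x] mult_left_le[OF e[of "m (N i)"], of "norm ?T"]
          by (simp add: c_def)
        ultimately show ?thesis by simp
      qed
      ultimately have "norm (scl (y (d n)) x) + 1 - 0 \<le> norm ?T"
        by (intro LIMSEQ_le_const2) auto
      then show ?thesis
        by (simp add: norm_scale)
    qed
    show "1 + norm (rank_one scl y x) \<le> norm ?T"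
    proof (cases "x = 0")
      case True
      with bound[of 0] show ?thesis by (simp add: norm_rank_one)
    next
      case False
      \<comment> \<open>The desired inequality is \<open>norm y \<le> b\<close>. It is known at the
        points \<open>d n\<close> and passes to the unit sphere by density, then to all vectors by
        scaling.\<close>
      define b where "b = (norm ?T - 1) / norm x"
      have b: "norm (y (d n)) \<le> b" for n
        using bound[of n] False by (simp add: b_def field_simps)
      have unit: "norm (y u) \<le> b" if u: "norm u = 1" for u
      proof (rule field_le_epsilon)
        fix r :: real assume r: "0 < r"
        have y1: "0 < norm y + 1"
          by (simp add: add_nonneg_pos)
        then obtain n where n: "dist (d n) u < r / (norm y + 1)"
          using dense[OF u, of "r / (norm y + 1)"] r by auto
        have "norm (y (u - d n)) \<le> (norm y + 1) * norm (u - d n)"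
          using norm_blinfun[of y "u - d n"] norm_ge_zero[of "u - d n"]
          unfolding distrib_right mult_1_left by linarith
        also have "\<dots> \<le> r"
          using n y1 by (simp add: dist_norm norm_minus_commute field_simps)
        finally show "norm (y u) \<le> b + r"
          using b[of n] norm_triangle_ineq[of "y (u - d n)" "y (d n)"] by (simp add: blinfun.diff_right)
      qed
      have "norm y \<le> b"
      proof (rule norm_blinfun_bound)
        show "0 \<le> b"
          using b[of 0] norm_ge_zero order_trans by blast
        show "norm (y z) \<le> b * norm z" for z
        proof (cases "z = 0")
          case False
          have "norm (y (sgn z)) = norm (y z) / norm z"
            by (simp add: sgn_div_norm blinfun.scaleR_right divide_inverse mult.commute)
          with unit[of "sgn z"] False show ?thesis
            by (simp add: norm_sgn field_simps)
        qed simp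
      qed
      with False show ?thesis
        by (simp add: norm_rank_one b_def field_simps)
    qed
  qed
  ultimately show ?thesis by blast
qed

section \<open>The equivalences over one scalar field\<close>

lemma daugavet_characterization:
  assumes sep: "separable_space (euclidean :: 'a topology)"
  shows "(thickness TYPE('a) = 2
        \<longleftrightarrow> (\<exists>e :: nat \<Rightarrow> 'a. range e \<subseteq> cball 0 1 \<and>
              (\<forall>x. (\<lambda>n. norm (x + e n)) \<longlonglongrightarrow> norm x + 1)))
      \<and> ((\<exists>e :: nat \<Rightarrow> 'a. range e \<subseteq> cball 0 1 \<and>
              (\<forall>x. (\<lambda>n. norm (x + e n)) \<longlonglongrightarrow> norm x + 1))
        \<longleftrightarrow> (\<exists>Y. norming_subspace scl Y \<and>
              (\<forall>x. \<forall>y\<in>Y. norm (id_blinfun + rank_one scl y x) = 1 + norm (rank_one scl y x))))"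
    (is "(?a \<longleftrightarrow> ?b) \<and> (?b \<longleftrightarrow> ?c)")
proof -
  have "?a \<Longrightarrow> ?b"
    using thickness_2_imp_asymptotically_additive[OF sep] by metis
  moreover have "?b \<Longrightarrow> ?a"
    using asymptotically_additive_imp_thickness_2 by blast
  moreover have "?b \<Longrightarrow> ?c"
    using asymptotically_additive_imp_norming_daugavet[OF sep]
    unfolding daugavet_def by (auto simp: image_subset_iff)
  moreover have "?c \<Longrightarrow> ?a"
    using daugavet_imp_thickness_2 unfolding daugavet_def by blast
  ultimately show ?thesis by blast
qed

end

section \<open>The real and the complex case\<close>

lemma normed_space_re_real:
  "normed_space_re (scaleR :: real \<Rightarrow> 'a::real_normed_vector \<Rightarrow> 'a) id"
proof -
  interpret normed_space_over "scaleR :: real \<Rightarrow> 'a \<Rightarrow> 'a"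
    by (rule normed_space_over_scaleR)
  show ?thesis
  proof
    show "\<exists>u::real. norm u = 1 \<and> u * c = of_real (norm c)" for c
      by (rule exI[of _ "if 0 \<le> c then 1 else - 1"]) auto
    show "\<exists>F. (\<forall>x y. F (x + y) = F x + F y) \<and> (\<forall>c x. F (c *\<^sub>R x) = c * F x) \<and> (\<forall>x. id (F x) = g x)"
      if "linear g" for g :: "'a \<Rightarrow> real"
      using linear_add[OF that] linear_scale[OF that] by (intro exI[of _ g]) auto
  qed auto
qed

lemma normed_space_re_complex:
  assumes "normed_space_over (scl :: complex \<Rightarrow> 'a::real_normed_vector \<Rightarrow> 'a)"
  shows "normed_space_re scl Re"
proof -
  interpret normed_space_over scl
    by fact
  show ?thesis
  proof
    show "Re c \<le> norm c" for c
      by (rule complex_Re_le_cmod)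
    show "\<exists>u. norm u = 1 \<and> u * c = of_real (norm c)" for c :: complex
    proof (cases "c = 0")
      case False
      then show ?thesis
        by (intro exI[of _ "of_real (norm c) / c"]) (simp add: norm_divide)
    qed (auto intro: exI[of _ 1])
    fix g :: "'a \<Rightarrow> real" assume g: "linear g"
    \<comment> \<open>Complex linearity forces the imaginary part, because the real part of
      \<open>\<i> * F x\<close> is minus the imaginary part of \<open>F x\<close>.\<close>
    define F where "F x = Complex (g x) (- g (scl \<i> x))" for x
    have "F (scl c x) = c * F x" for c x
    proof -
      \<comment> \<open>Since \<open>g\<close> is only real-linear, a complex scalar is expressed by
        real multiples of \<open>z\<close> and \<open>scl \<i> z\<close>.\<close>
      have split: "scl c z = Re c *\<^sub>R z + Im c *\<^sub>R scl \<i> z" for z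
      proof -
        have "c = of_real (Re c) + of_real (Im c) * \<i>"
          by (simp add: complex_eq mult.commute)
        then have "scl c z = scl (of_real (Re c)) z + scl (of_real (Im c)) (scl \<i> z)"
          by (metis scale_left_distrib scale_scale)
        then show ?thesis
          by (simp only: scale_of_real)
      qed
      have "scl \<i> (scl c x) = scl c (scl \<i> x)"
        by (simp add: mult.commute)
      also have "\<dots> = Re c *\<^sub>R scl \<i> x + Im c *\<^sub>R scl \<i> (scl \<i> x)"
        by (rule split)
      also have "\<dots> = Re c *\<^sub>R scl \<i> x - Im c *\<^sub>R x"
        by simp
      finally have i: "g (scl \<i> (scl c x)) = Re c * g (scl \<i> x) - Im c * g x"
        by (simp only: linear_diff[OF g] linear_scale[OF g] real_scaleR_def)
      have "g (scl c x) = Re c * g x + Im c * g (scl \<i> x)"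
        by (simp only: split[of x] linear_add[OF g] linear_scale[OF g] real_scaleR_def)
      with i show ?thesis
        by (simp add: F_def complex_eq_iff del: scale_scale)
    qed
    moreover have "F (x + y) = F x + F y" for x y
      by (simp add: F_def scale_right_distrib linear_add[OF g] complex_eq_iff)
    ultimately show "\<exists>F. (\<forall>x y. F (x + y) = F x + F y) \<and> (\<forall>c x. F (scl c x) = c * F x) \<and> (\<forall>x. Re (F x) = g x)"
      by (intro exI[of _ F]) (simp add: F_def)
  qed simp_all
qed

theorem theorem1p1:
  assumes separable: "separable_space (euclidean :: 'a::banach topology)"
  shows
    "((thickness TYPE('a) = 2
        \<longleftrightarrow> (\<exists>e :: nat \<Rightarrow> 'a. range e \<subseteq> cball 0 1 \<and>
              (\<forall>x. (\<lambda>n. norm (x + e n)) \<longlonglongrightarrow> norm x + 1)))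
      \<and> ((\<exists>e :: nat \<Rightarrow> 'a. range e \<subseteq> cball 0 1 \<and>
              (\<forall>x. (\<lambda>n. norm (x + e n)) \<longlonglongrightarrow> norm x + 1))
        \<longleftrightarrow> (\<exists>Y :: ('a \<Rightarrow>\<^sub>L real) set. norming_subspace scaleR Y \<and>
              (\<forall>x. \<forall>y\<in>Y. norm (id_blinfun + rank_one scaleR y x)
                 = 1 + norm (rank_one scaleR y x)))))
     \<and> (\<forall>scl :: complex \<Rightarrow> 'a \<Rightarrow> 'a. normed_space_over scl \<longrightarrow>
      (thickness TYPE('a) = 2
        \<longleftrightarrow> (\<exists>e :: nat \<Rightarrow> 'a. range e \<subseteq> cball 0 1 \<and>
              (\<forall>x. (\<lambda>n. norm (x + e n)) \<longlonglongrightarrow> norm x + 1)))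
      \<and> ((\<exists>e :: nat \<Rightarrow> 'a. range e \<subseteq> cball 0 1 \<and>
              (\<forall>x. (\<lambda>n. norm (x + e n)) \<longlonglongrightarrow> norm x + 1))
        \<longleftrightarrow> (\<exists>Y :: ('a \<Rightarrow>\<^sub>L complex) set. norming_subspace scl Y \<and>
              (\<forall>x. \<forall>y\<in>Y. norm (id_blinfun + rank_one scl y x)
                 = 1 + norm (rank_one scl y x)))))"
  using normed_space_re.daugavet_characterization[OF normed_space_re_real separable]
    normed_space_re.daugavet_characterization[OF normed_space_re_complex separable]
  by blast

end
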